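(* Let $n\ge 2$, $v=(4^n-2^n)/2$, and let $s$ satisfy $2\le v-s\le 2^{n-1}$. Let $\bar S=\{g_{s+1},\ldots,g_v\}\subset\Omega$ be the even set whose matrix $\bar G=[g_{s+1}\cdots g_v]$ has the form $$\bar G=\begin{bmatrix}1 & 1'_{v-s-1}\\ 0_{n-1} & 2B\end{bmatrix},$$ where $B$ is an $(n-1)\times(v-s-1)$ binary matrix with distinct nonnull columns, and let $d$ be the two-level regular design associated with $B$. Then $\bar S$ yields an MA QC design in $2s+1$ factors and $2^{2n}$ runs if and only if the matrix $B$ is so chosen that (among all $(n-1)\times(v-s-1)$ binary matrices with distinct nonnull columns) the associated design $d$ sequentially minimizes $E_{2r}(d)$, for $r=2,3,\ldots$, where $$E_{2r}(d)=\sum_{k=0}^{2r}\binom{v-s-1-k}{\langle r-k/2\rangle}2^{k}A_k(d).$$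
   Context: Two-level designs and wordlength pattern. A two-level design in $N$ runs and $q$ factors is an $N\times q$ matrix $D$ with entries $\pm1$ (rows = runs, possibly repeated; columns = factors). For a set $H$ of $k$ columns of $D$, $\rho_k(H;D)$ is the absolute value of the arithmetic mean of the $N$ entries of the entrywise (Schur) product of the columns in $H$. The wordlength pattern is $(A_1(D),\ldots,A_q(D))$, where $A_k(D)=\sum_H\rho_k(H;D)^2$, the sum being over all sets $H$ of $k$ columns. "Sequentially minimizes" a sequence of quantities means lexicographic minimization: minimize the first, then the second among minimizers of the first, and so on. Quaternary code (QC) designs with an odd number of factors. $Z_4$ denotes the integers mod 4; an element is even if it is 0 or 2 and odd otherwise. $\Delta=Z_4^n$ (column vectors). $\Omega\subset\Delta$ is the set of the $v=(4^n-2^n)/2$ vectors having at least one odd element and whose first odd element is 1. For $s+1$ distinct vectors $g_1,\ldots,g_{s+1}\in\Omega$, let $D_{\mathrm{even}}$ be the $2^{2n}\times 2(s+1)$ matrix whose rows are indexed by $u\in\Delta$, the row of $u$ being obtained from $(u'g_1,\ldots,u'g_{s+1})$ (reduced mod 4) by replacing each entry by a pair via the Gray map $0\to(1,1)$, $1\to(1,-1)$, $2\to(-1,-1)$, $3\to(-1,1)$. A QC design $D_{\mathrm{odd}}$ in $2s+1$ factors and $2^{2n}$ runs is obtained by deleting one column of $D_{\mathrm{even}}$; without loss of generality the deleted column is the second of the two columns contributed by $g_{s+1}$. Such a design always has $A_1=A_2=0$. $D_{\mathrm{odd}}$ is an MA (minimum aberration) QC design if it sequentially minimizes $A_3(D_{\mathrm{odd}}),\ldots,A_{2s+1}(D_{\mathrm{odd}})$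 among all QC designs in $2s+1$ factors and $2^{2n}$ runs so obtained (over all choices of $g_1,\ldots,g_{s+1}$). A set $\bar S=\{g_{s+1},g_{s+2},\ldots,g_v\}\subset\Omega$ of $v-s$ vectors with distinguished element $g_{s+1}$ is said to yield the design $D_{\mathrm{odd}}$ obtained in this way from $\{g_1,\ldots,g_s\}=\Omega\setminus\bar S$ together with $g_{s+1}$. In the claim, $g_{s+1}=(1,0,\ldots,0)'$ is the first column of $\bar G$. A set $\bar S$ is even if $g_j+g_k$ has all elements even for every $s+1\le j,k\le v$. (Because elementary row operations leave the row space of $\bar G$ invariant, the paper takes, without loss of generality, $\bar G$ for an even set in the form displayed in the claim.) Here $0_{n-1}$ is the column vector of $n-1$ zeros, $1'_{v-s-1}$ the row vector of $v-s-1$ ones, and the entries of $B$ are $0,1$. The regular design $d$ associated with (generated by) $B=[b_{s+2}\cdots b_v]$ is the $2^{n-1}\times(v-s-1)$ matrix with rows indexed by $x\in\{0,1\}^{n-1}$, the row of $x$ being $\left((-1)^{x'b_{s+2}},\ldots,(-1)^{x'b_v}\right)$; rows may be repeated. Conventions for $E_{2r}(d)$: $A_0(d)=1$; $A_k(d)=0$ for $k>v-s-1$ (such terms are zero); $\langle y\rangle$ is the largest integer in $y$ (floor of $y$); the binomial coefficient is interpreted as zero if $\langle r-k/2\rangle$ exceeds $v-s-1-k$. *)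

theory Defs
  imports "Jordan_Normal_Form.Matrix" "HOL-Library.Numeral_Type" "HOL.Real"
begin

text \<open>Rows and columns of a design are indexed by arbitrary finite sets rather than by initial
  segments of the naturals; repeated rows and columns are possible because the index sets,
  not the rows themselves, are what is summed over.\<close>

datatype ('r, 'c) design =
  Design (runs: "'r set") (factors: "'c set") (entry: "'r \<Rightarrow> 'c \<Rightarrow> real")

definition rho :: "('r, 'c) design \<Rightarrow> 'c set \<Rightarrow> real" where
  "rho D H = \<bar>(\<Sum>u\<in>runs D. \<Prod>c\<in>H. entry D u c) / real (card (runs D))\<bar>"

definition wordlength :: "('r, 'c) design \<Rightarrow> nat \<Rightarrow> real" where
  "wordlength D k = (\<Sum>H | H \<subseteq> factors D \<and> card H = k. (rho D H)\<^sup>2)"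

text \<open>Minimize \<open>f _ k\<close> for the first index in \<open>K\<close>, then for the second among the minimizers of the
  first, and so on: if \<open>x\<close> has survived all stages before \<open>k\<close>, the other survivors are exactly
  the \<open>y\<close> that agree with \<open>x\<close> on the earlier indices.\<close>

definition sequentially_minimizes ::
    "'a set \<Rightarrow> ('a \<Rightarrow> nat \<Rightarrow> real) \<Rightarrow> nat set \<Rightarrow> 'a \<Rightarrow> bool" where
  "sequentially_minimizes C f K x \<longleftrightarrow> x \<in> C \<and>
     (\<forall>k\<in>K. \<forall>y\<in>C. (\<forall>j\<in>K. j < k \<longrightarrow> f y j = f x j) \<longrightarrow> f x k \<le> f y k)"

text \<open>The numeral type \<open>4\<close> is the ring of integers modulo 4.\<close>

type_synonym z4 = "4"

definition z4_even :: "z4 \<Rightarrow> bool" where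
  "z4_even a \<longleftrightarrow> a = 0 \<or> a = 2"

definition Delta :: "nat \<Rightarrow> z4 vec set" where
  "Delta n = carrier_vec n"

definition Omega :: "nat \<Rightarrow> z4 vec set" where
  "Omega n = {g \<in> Delta n. \<exists>i<n. \<not> z4_even (g $ i) \<and> (\<forall>j<i. z4_even (g $ j)) \<and> g $ i = 1}"

definition gray :: "z4 \<Rightarrow> real \<times> real" where
  "gray a = (if a = 0 then (1, 1) else if a = 1 then (1, -1)
             else if a = 2 then (-1, -1) else (-1, 1))"

text \<open>The generating vectors being distinct, the two columns contributed by \<open>g\<close> are indexed by
  \<open>(g, 1)\<close> and \<open>(g, 2)\<close>.\<close>

definition even_design :: "nat \<Rightarrow> z4 vec set \<Rightarrow> (z4 vec, z4 vec \<times> nat) design" where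
  "even_design n T = Design (Delta n) (T \<times> {1, 2})
     (\<lambda>u (g, b). if b = 1 then fst (gray (u \<bullet> g)) else snd (gray (u \<bullet> g)))"

definition delete_factor :: "'c \<Rightarrow> ('r, 'c) design \<Rightarrow> ('r, 'c) design" where
  "delete_factor c D = Design (runs D) (factors D - {c}) (entry D)"

text \<open>Any one of the columns may be deleted. Restricting to second columns would lose nothing:
  the row permutation \<open>u \<mapsto> -u\<close> interchanges the two columns of every pair.\<close>

definition QC_designs_odd :: "nat \<Rightarrow> nat \<Rightarrow> (z4 vec, z4 vec \<times> nat) design set" where
  "QC_designs_odd n s = {delete_factor c (even_design n T) | c T.
     T \<subseteq> Omega n \<and> card T = s + 1 \<and> c \<in> T \<times> {1, 2}}"

definition MA_QC_design :: "nat \<Rightarrow> nat \<Rightarrow> (z4 vec, z4 vec \<times> nat) design \<Rightarrow> bool" where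
  "MA_QC_design n s D \<longleftrightarrow>
     sequentially_minimizes (QC_designs_odd n s) wordlength {3..2 * s + 1} D"

definition yielded_design ::
    "nat \<Rightarrow> z4 vec set \<Rightarrow> z4 vec \<Rightarrow> (z4 vec, z4 vec \<times> nat) design" where
  "yielded_design n S g = delete_factor (g, 2) (even_design n (insert g (Omega n - S)))"

definition even_set :: "z4 vec set \<Rightarrow> bool" where
  "even_set S \<longleftrightarrow> (\<forall>g\<in>S. \<forall>h\<in>S. \<forall>i<dim_vec (g + h). z4_even ((g + h) $ i))"

definition binary_matrices :: "nat \<Rightarrow> nat \<Rightarrow> nat mat set" where
  "binary_matrices p m = {B \<in> carrier_mat p m.
     elements_mat B \<subseteq> {0, 1} \<and> distinct (cols B) \<and> 0\<^sub>v p \<notin> set (cols B)}"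

definition G_bar :: "nat mat \<Rightarrow> z4 mat" where
  "G_bar B = four_block_mat
     (1\<^sub>m 1)              (mat 1 (dim_col B) (\<lambda>_. 1))
     (0\<^sub>m (dim_row B) 1)  (2 \<cdot>\<^sub>m map_mat of_nat B)"

definition regular_design :: "nat mat \<Rightarrow> (nat vec, nat) design" where
  "regular_design B = Design
     {x \<in> carrier_vec (dim_row B). \<forall>i<dim_row B. x $ i \<in> {0, 1}}
     {..<dim_col B}
     (\<lambda>x j. (-1) ^ (x \<bullet> col B j))"

text \<open>\<open>E_even d r\<close> stands for \<open>E\<^sub>2\<^sub>r(d)\<close>. For \<open>k > card (factors d)\<close> the truncated subtraction is
  harmless, as \<open>wordlength d k = 0\<close>.\<close>

definition E_even :: "('r, 'c) design \<Rightarrow> nat \<Rightarrow> real" where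
  "E_even d r = (\<Sum>k = 0..2 * r.
     real ((card (factors d) - k) choose nat \<lfloor>real r - real k / 2\<rfloor>) * 2 ^ k * wordlength d k)"

end

theory Submission
  imports Defs "HOL-Computational_Algebra.Polynomial" "HOL.Transcendental"
begin

text \<open>
  The Gray map turns differences modulo 4 into products of signs, so the generating polynomial of
  the wordlength pattern is an average over \<open>u\<close> of products \<open>1 \<plusminus> x\<close>, determined by the row sums of the
  design; these are the known row sums of the design of all of \<open>Omega\<close> minus the row sums \<open>L\<close> of the
  complementary columns.

  Third moments give \<open>A\<^sub>3\<close>. Pairs of complementary columns from different classes modulo 2 lower the
  second moment of \<open>L\<close> over the even \<open>u\<close>, at cost \<open>3 \<sqdot> 4\<^sup>n\<close> per pair, while the third moment of \<open>L\<close>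
  gains at most \<open>2 \<sqdot> 4\<^sup>n\<close> per such pair. Hence \<open>A\<^sub>3\<close> is minimal exactly for even sets.

  For an even set, writing \<open>t\<close> for the row sums of the regular design and \<open>x\<close> for the hyperbolic tangent
  of \<open>\<theta>\<close>, the part of the generating function depending on \<open>B\<close> is a sum of terms \<open>cosh ((2t + 1)\<theta>)\<close>.
  The same sum arises from the \<open>E\<^sub>2\<^sub>r\<close>: substituting \<open>2x / (1 + x\<^sup>2)\<close>, the hyperbolic tangent of \<open>2\<theta>\<close>,
  into the wordlength enumerator of \<open>d\<close> produces the binomial coefficients in their definition. So, up
  to a factor \<open>(1 - x\<^sup>2) ^ (s - m) / 2\<close>, differences of the two generating functions coincide, and both
  lexicographic orders agree.
\<close>

section \<open>Integers modulo 4 and the Gray map\<close>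

lemma z4_exhaust:
  fixes a :: z4
  obtains "a = 0" | "a = 1" | "a = 2" | "a = 3"
proof -
  have "card {0, 1, 2, 3 :: z4} = card (UNIV :: z4 set)" by simp
  then have "{0, 1, 2, 3 :: z4} = UNIV" by (intro card_subset_eq) auto
  then show ?thesis using that by blast
qed

lemma z4_even_add: "z4_even (a + b) \<longleftrightarrow> (z4_even a \<longleftrightarrow> z4_even b)"
  by (cases a rule: z4_exhaust; cases b rule: z4_exhaust) (simp_all add: z4_even_def)

lemma z4_even_sum: "(\<And>i. i \<in> I \<Longrightarrow> z4_even (f i)) \<Longrightarrow> z4_even (sum f I)"
  by (induction I rule: infinite_finite_induct) (auto simp: z4_even_add z4_even_def[of 0])

lemma z4_even_minus [simp]: "z4_even (- a) \<longleftrightarrow> z4_even a"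
  by (cases a rule: z4_exhaust) (simp_all add: z4_even_def)

lemma z4_even_diff: "z4_even (a - b) \<longleftrightarrow> (z4_even a \<longleftrightarrow> z4_even b)"
  using z4_even_add[of a "- b"] by simp

lemma z4_even_0 [simp]: "z4_even 0" by (simp add: z4_even_def)

lemma z4_even_2_mult [simp]: "z4_even (2 * a)"
  by (cases a rule: z4_exhaust) (simp_all add: z4_even_def)

lemma z4_odd_double: "\<not> z4_even a \<Longrightarrow> 2 * a = 2"
  by (cases a rule: z4_exhaust) (simp_all add: z4_even_def)

lemma z4_even_mult: "z4_even a \<Longrightarrow> z4_even (a * b)"
  by (cases a rule: z4_exhaust; cases b rule: z4_exhaust) (simp_all add: z4_even_def)

definition gval :: "nat \<Rightarrow> z4 \<Rightarrow> real" where
  "gval b a = (if b = 1 then fst (gray a) else snd (gray a))"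

lemma gval_cases: "gval b a = 1 \<or> gval b a = - 1"
  by (simp add: gval_def gray_def)

lemma gval_square [simp]: "gval b a * gval b a = 1"
  using gval_cases[of b a] by auto

lemma gval_0 [simp]: "gval b 0 = 1"
  by (simp add: gval_def gray_def)

lemma gval_2 [simp]: "gval b 2 = - 1"
  by (simp add: gval_def gray_def)

lemma gval_add_2: "gval b (a + 2) = - gval b a"
  by (cases a rule: z4_exhaust) (simp_all add: gval_def gray_def)

lemma gval_even: "z4_even a \<Longrightarrow> gval b a = gval b' a"
  by (auto simp: z4_even_def)

lemma gval_minus: "gval 1 (- a) = gval 2 a" "gval 2 (- a) = gval 1 a"
  by (cases a rule: z4_exhaust; simp add: gval_def gray_def)+

lemma gval_odd_sum: "\<not> z4_even a \<Longrightarrow> gval 1 a + gval 2 a = 0"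
  by (cases a rule: z4_exhaust) (simp_all add: z4_even_def gval_def gray_def)

text \<open>With \<open>gval 1 a\<close> and \<open>gval 2 a\<close> being the sum and the difference of the real and imaginary part
  of \<open>i ^ a\<close>, these are product-to-sum formulas.\<close>

lemma gval_mult:
  "gval 1 a * gval 1 b = (gval 1 (a + b) - gval 2 (a + b) + gval 1 (a - b) + gval 2 (a - b)) / 2"
  "gval 2 a * gval 2 b = (- gval 1 (a + b) + gval 2 (a + b) + gval 1 (a - b) + gval 2 (a - b)) / 2"
  "gval 1 a * gval 2 b = (gval 1 (a + b) + gval 2 (a + b) + gval 1 (a - b) - gval 2 (a - b)) / 2"
  "gval 2 a * gval 1 b = (gval 1 (a + b) + gval 2 (a + b) - gval 1 (a - b) + gval 2 (a - b)) / 2"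
  by (cases a rule: z4_exhaust; cases b rule: z4_exhaust; simp add: gval_def gray_def)+

lemma gval_not_1: "b \<noteq> 1 \<Longrightarrow> gval b = gval 2"
  by (auto simp: gval_def)

text \<open>A uniform shape for the four formulas in \<open>gval_mult\<close>. Later arguments need
  only the size of the coefficients, not the individual signs.\<close>

lemma gval_mult_signs:
  obtains p q r t :: real where "\<bar>p\<bar> \<le> 1" "\<bar>q\<bar> \<le> 1" "\<bar>r\<bar> \<le> 1" "\<bar>t\<bar> \<le> 1"
    "\<And>x y. gval b x * gval b' y = (p * gval 1 (x + y) + q * gval 2 (x + y) + r * gval 1 (x - y) + t * gval 2 (x - y)) / 2"
proof (cases "b = 1")
  case b: True
  show thesis
  proof (cases "b' = 1")
    case True
    then show thesis using b by (intro that[of 1 "-1" 1 1]) (simp_all add: gval_mult del: One_nat_def)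
  next
    case False
    then show thesis
      using b by (intro that[of 1 1 1 "-1"]) (simp_all add: gval_mult gval_not_1[OF False] del: One_nat_def)
  qed
next
  case b: False
  show thesis
  proof (cases "b' = 1")
    case True
    then show thesis
      using b by (intro that[of 1 1 "-1" 1]) (simp_all add: gval_mult gval_not_1[OF b] del: One_nat_def)
  next
    case False
    then show thesis
      using b by (intro that[of "-1" 1 1 1])
        (simp_all add: gval_mult gval_not_1[OF False] gval_not_1[OF b] del: One_nat_def)
  qed
qed

text \<open>Both sides are twice the real part of \<open>i ^ (a - b)\<close>. Together with
  \<open>gval_pair_diff_prod\<close> this says that the two products for a complete pair have the
  same sum and the same product as the pair at \<open>a - b\<close>, hence the same quadratic factor
  in the generating polynomial.\<close>

lemma gval_pair_diff:
  "gval 1 a * gval 1 b + gval 2 a * gval 2 b = gval 1 (a - b) + gval 2 (a - b)"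
  by (cases a rule: z4_exhaust; cases b rule: z4_exhaust; simp add: gval_def gray_def)

lemma gval_pair_diff_prod:
  "(gval 1 a * gval 1 b) * (gval 2 a * gval 2 b) = gval 1 (a - b) * gval 2 (a - b)"
  by (cases a rule: z4_exhaust; cases b rule: z4_exhaust; simp add: gval_def gray_def)

text \<open>Raising both arguments by 1 multiplies both powers of \<open>i\<close> by
  \<open>i\<close>, which exchanges real and imaginary parts up to sign. The mixed terms of the two
  products therefore cancel, and the choice of column \<open>b\<close> disappears.\<close>

lemma gval_shift_1: "gval b a * gval b c + gval b (a + 1) * gval b (c + 1) = gval 1 (a - c) + gval 2 (a - c)"
  by (cases a rule: z4_exhaust; cases c rule: z4_exhaust; cases "b = 1"; simp add: gval_def gray_def)

text \<open>The character of order two of the additive group of \<open>z4\<close>, that is, the sign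
  (-1)^a.\<close>

definition chi :: "z4 \<Rightarrow> real" where
  "chi a = (if z4_even a then 1 else - 1)"

lemma chi_0 [simp]: "chi 0 = 1" by (simp add: chi_def)

lemma chi_cases: "chi a = 1 \<or> chi a = - 1"
  by (simp add: chi_def)

lemma chi_add: "chi (a + b) = chi a * chi b"
  by (simp add: chi_def z4_even_add)

lemma chi_sum: "finite A \<Longrightarrow> chi (sum f A) = (\<Prod>a\<in>A. chi (f a))"
  by (induction rule: finite_induct) (simp_all add: chi_add)

text \<open>Adding \<open>2 * c\<close> multiplies \<open>i ^ a\<close> by (-1)^c. This is how
  vectors congruent modulo 2 come to have columns that differ only by binary characters.\<close>

lemma gval_add_double: "gval b (a + 2 * c) = gval b a * chi c"
  by (cases a rule: z4_exhaust; cases c rule: z4_exhaust; cases "b = 1";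
      simp add: gval_def gray_def chi_def z4_even_def)

definition parity :: "z4 \<Rightarrow> nat" where
  "parity a = (if z4_even a then 0 else 1)"

lemma chi_mult_of_nat: "k \<in> {0, 1} \<Longrightarrow> chi (a * of_nat k) = (- 1) ^ (parity a * k)"
proof -
  assume "k \<in> {0, 1}"
  then consider "k = 0" | "k = 1" by blast
  then show ?thesis
  proof cases
    case 1
    show ?thesis unfolding 1 by simp
  next
    case 2
    have "chi a = (- 1) ^ parity a" unfolding chi_def parity_def by simp
    then show ?thesis unfolding 2 by simp
  qed
qed

section \<open>Vectors over the integers modulo 4 and the subgroup of even vectors\<close>

lemma vec_bij_PiE:
  "bij_betw (\<lambda>f. vec n f) ({..<n} \<rightarrow>\<^sub>E A) {u \<in> carrier_vec n. \<forall>i<n. u $ i \<in> A}"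
proof (rule bij_betwI[where g = "\<lambda>u. restrict (\<lambda>i. u $ i) {..<n}"])
  fix f assume f: "f \<in> {..<n} \<rightarrow>\<^sub>E A"
  show "restrict (\<lambda>i. vec n f $ i) {..<n} = f"
  proof -
    have "restrict (\<lambda>i. vec n f $ i) {..<n} = restrict f {..<n}"
      by (rule restrict_ext) simp
    then show ?thesis using PiE_restrict[OF f] by simp
  qed
next
  fix u assume "u \<in> {u \<in> carrier_vec n. \<forall>i<n. u $ i \<in> A}"
  then show "vec n (restrict (\<lambda>i. u $ i) {..<n}) = u"
    by (intro eq_vecI) auto
next
  show "vec n \<in> ({..<n} \<rightarrow>\<^sub>E A) \<rightarrow> {u \<in> carrier_vec n. \<forall>i<n. u $ i \<in> A}"
    by (auto simp: PiE_def Pi_def)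
next
  show "(\<lambda>u. restrict (\<lambda>i. u $ i) {..<n}) \<in> {u \<in> carrier_vec n. \<forall>i<n. u $ i \<in> A} \<rightarrow> ({..<n} \<rightarrow>\<^sub>E A)"
    by (intro Pi_I restrict_PiE_iff[THEN iffD2]) auto
qed

lemma card_vecs: "card {u \<in> carrier_vec n. \<forall>i<n. u $ i \<in> A} = card A ^ n"
  using bij_betw_same_card[OF vec_bij_PiE[of n A]] by (simp add: card_funcsetE)

lemma finite_vecs: "finite A \<Longrightarrow> finite {u \<in> carrier_vec n. \<forall>i<n. u $ i \<in> A}"
  using bij_betw_finite[OF vec_bij_PiE[of n A]] by (simp add: finite_PiE)

definition Even :: "nat \<Rightarrow> z4 vec set" where
  "Even n = {u \<in> Delta n. \<forall>i<n. z4_even (u $ i)}"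

lemma Delta_eq: "Delta n = {u \<in> carrier_vec n. \<forall>i<n. u $ i \<in> UNIV}"
  by (auto simp: Delta_def)

lemma finite_Delta [simp]: "finite (Delta n)"
  unfolding Delta_eq by (rule finite_vecs) simp

lemma card_Delta: "card (Delta n) = 4 ^ n"
  unfolding Delta_eq card_vecs by simp

lemma Even_subset: "Even n \<subseteq> Delta n" by (auto simp: Even_def)

lemma finite_Even [simp]: "finite (Even n)"
  using finite_subset[OF Even_subset finite_Delta] .

lemma card_Even: "card (Even n) = 2 ^ n"
proof -
  have "Even n = {u \<in> carrier_vec n. \<forall>i<n. u $ i \<in> {0, 2 :: z4}}"
    by (auto simp: Even_def Delta_def z4_even_def)
  then show ?thesis using card_vecs[of n "{0, 2 :: z4}"] by (simp add: numeral_2_eq_2[symmetric])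
qed

lemma Delta_0 [simp]: "0\<^sub>v n \<in> Delta n" by (simp add: Delta_def)
lemma Even_0 [simp]: "0\<^sub>v n \<in> Even n" by (simp add: Even_def)

lemma Delta_closed [simp, intro]:
  "u \<in> Delta n \<Longrightarrow> w \<in> Delta n \<Longrightarrow> u + w \<in> Delta n"
  "u \<in> Delta n \<Longrightarrow> w \<in> Delta n \<Longrightarrow> u - w \<in> Delta n"
  "u \<in> Delta n \<Longrightarrow> - u \<in> Delta n"
  "u \<in> Delta n \<Longrightarrow> c \<cdot>\<^sub>v u \<in> Delta n"
  by (auto simp: Delta_def)

lemma Delta_dim [simp]: "u \<in> Delta n \<Longrightarrow> dim_vec u = n" by (auto simp: Delta_def)

lemma unit_Delta [simp]: "unit_vec n i \<in> Delta n" by (simp add: Delta_def)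

lemma add_dot: "u \<in> Delta n \<Longrightarrow> w \<in> Delta n \<Longrightarrow> h \<in> Delta n \<Longrightarrow> (u + w) \<bullet> h = u \<bullet> h + w \<bullet> h" for u w h :: "z4 vec"
  by (auto simp: Delta_def scalar_prod_def algebra_simps sum.distrib sum_subtractf sum_negf sum_distrib_left)

lemma diff_dot: "u \<in> Delta n \<Longrightarrow> w \<in> Delta n \<Longrightarrow> h \<in> Delta n \<Longrightarrow> (u - w) \<bullet> h = u \<bullet> h - w \<bullet> h" for u w h :: "z4 vec"
  by (auto simp: Delta_def scalar_prod_def algebra_simps sum.distrib sum_subtractf sum_negf sum_distrib_left)

lemma dot_add: "u \<in> Delta n \<Longrightarrow> h \<in> Delta n \<Longrightarrow> k \<in> Delta n \<Longrightarrow> u \<bullet> (h + k) = u \<bullet> h + u \<bullet> k" for u h k :: "z4 vec"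
  by (auto simp: Delta_def scalar_prod_def algebra_simps sum.distrib sum_subtractf sum_negf sum_distrib_left)

lemma dot_diff: "u \<in> Delta n \<Longrightarrow> h \<in> Delta n \<Longrightarrow> k \<in> Delta n \<Longrightarrow> u \<bullet> (h - k) = u \<bullet> h - u \<bullet> k" for u h k :: "z4 vec"
  by (auto simp: Delta_def scalar_prod_def algebra_simps sum.distrib sum_subtractf sum_negf sum_distrib_left)

lemma dot_minus: "u \<in> Delta n \<Longrightarrow> h \<in> Delta n \<Longrightarrow> u \<bullet> (- h) = - (u \<bullet> h)" for u h :: "z4 vec"
  by (auto simp: Delta_def scalar_prod_def algebra_simps sum.distrib sum_subtractf sum_negf sum_distrib_left)

lemma smult_dot: "u \<in> Delta n \<Longrightarrow> h \<in> Delta n \<Longrightarrow> (c \<cdot>\<^sub>v u) \<bullet> h = c * (u \<bullet> h)" for u h :: "z4 vec"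
  by (auto simp: Delta_def scalar_prod_def algebra_simps sum.distrib sum_subtractf sum_negf sum_distrib_left)

lemma dot_smult: "u \<in> Delta n \<Longrightarrow> h \<in> Delta n \<Longrightarrow> u \<bullet> (c \<cdot>\<^sub>v h) = c * (u \<bullet> h)" for u h :: "z4 vec"
  by (auto simp: Delta_def scalar_prod_def algebra_simps sum.distrib sum_subtractf sum_negf sum_distrib_left)

lemmas dot_linear = add_dot diff_dot dot_add dot_diff dot_minus smult_dot dot_smult

lemma dot_unit:
  fixes h :: "z4 vec"
  assumes "h \<in> Delta n" "i < n"
  shows "unit_vec n i \<bullet> h = h $ i" "h \<bullet> unit_vec n i = h $ i"
  using assms by (auto simp: Delta_def)

lemma dot_0 [simp]:
  fixes h :: "z4 vec"
  assumes "h \<in> Delta n" shows "0\<^sub>v n \<bullet> h = 0" "h \<bullet> 0\<^sub>v n = 0"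
  using assms by (auto simp: Delta_def)

lemma vec_shift_cancel:
  fixes u w :: "z4 vec"
  assumes "u \<in> Delta n" "w \<in> Delta n"
  shows "u + w - w = u" "u - w + w = u"
  using assms by (auto simp: Delta_def intro!: eq_vecI)

lemma sum_shift:
  assumes "w \<in> Delta n"
  shows "(\<Sum>u\<in>Delta n. F (u + w)) = (\<Sum>u\<in>Delta n. F u)"
  by (rule sum.reindex_bij_witness[where i = "\<lambda>u. u - w" and j = "\<lambda>u. u + w"])
    (simp_all add: vec_shift_cancel assms)

lemma Even_D: "u \<in> Even n \<Longrightarrow> u \<in> Delta n"
  by (simp add: Even_def)

lemma Even_closed [intro]: "u \<in> Even n \<Longrightarrow> w \<in> Even n \<Longrightarrow> u + w \<in> Even n"
  "u \<in> Even n \<Longrightarrow> w \<in> Even n \<Longrightarrow> u - w \<in> Even n"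
  by (auto simp: Even_def Delta_def z4_even_add z4_even_diff)

lemma sum_shift_Even:
  assumes "w \<in> Even n"
  shows "(\<Sum>u\<in>Even n. F (u + w)) = (\<Sum>u\<in>Even n. F u)"
  by (rule sum.reindex_bij_witness[where i = "\<lambda>u. u - w" and j = "\<lambda>u. u + w"])
    (simp_all add: vec_shift_cancel[where n = n] Even_D Even_closed assms)

lemma double_unit_Even: "2 \<cdot>\<^sub>v unit_vec n i \<in> Even n"
  by (auto simp: Even_def)

lemma Even_dot_even:
  fixes u h :: "z4 vec"
  assumes "u \<in> Even n" "h \<in> Delta n"
  shows "z4_even (u \<bullet> h)"
  unfolding scalar_prod_def using assms
  by (intro z4_even_sum) (auto simp: Even_def z4_even_mult)

lemma Even_dot_Even:
  fixes u h :: "z4 vec"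
  assumes "u \<in> Even n" "h \<in> Even n"
  shows "u \<bullet> h = 0"
  unfolding scalar_prod_def using assms
  by (intro sum.neutral) (fastforce simp: Even_def z4_even_def)

section \<open>Vanishing of sums by translation\<close>

lemma sum_gval_Delta:
  assumes "k \<in> Delta n"
  shows "(\<Sum>u\<in>Delta n. gval b (u \<bullet> k)) = (if k = 0\<^sub>v n then 4 ^ n else 0)"
proof (cases "k = 0\<^sub>v n")
  case True
  then show ?thesis by (simp add: card_Delta)
next
  case False
  \<comment> \<open>Translation by such a \<open>w\<close> negates every summand. At a nonzero entry
    of \<open>k\<close>, the unit vector serves if the entry is 2, and its double if the entry is
    odd.\<close>
  obtain w where w: "w \<in> Delta n" "w \<bullet> k = 2"
  proof -
    obtain j where j: "j < n" "k $ j \<noteq> 0" using False assms by (auto simp: Delta_def vec_eq_iff)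
    show thesis
    proof (cases "z4_even (k $ j)")
      case True
      then show thesis using j assms
        by (intro that[of "unit_vec n j"]) (auto simp: dot_unit z4_even_def)
    next
      case False
      then show thesis using j assms
        by (intro that[of "2 \<cdot>\<^sub>v unit_vec n j"]) (auto simp: dot_linear dot_unit z4_odd_double)
    qed
  qed
  have "(\<Sum>u\<in>Delta n. gval b (u \<bullet> k)) = (\<Sum>u\<in>Delta n. gval b ((u + w) \<bullet> k))"
    by (rule sum_shift[OF w(1), symmetric])
  also have "\<dots> = - (\<Sum>u\<in>Delta n. gval b (u \<bullet> k))"
    using w assms by (simp add: dot_linear gval_add_2 sum_negf)
  finally show ?thesis using False by simp
qed

text \<open>For sums over \<open>Even n\<close> the translation has to stay inside the even vectors,
  so only doubled unit vectors are available, and these need an odd entry of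
  \<open>k\<close>.\<close>

lemma not_Even_witness:
  assumes "k \<in> Delta n" "k \<notin> Even n"
  obtains w where "w \<in> Even n" "w \<bullet> k = 2"
proof -
  obtain j where j: "j < n" "\<not> z4_even (k $ j)" using assms by (auto simp: Even_def)
  then show thesis using assms that[of "2 \<cdot>\<^sub>v unit_vec n j"]
    by (auto simp: dot_linear dot_unit z4_odd_double double_unit_Even)
qed

lemma sum_gval_Even:
  assumes "k \<in> Delta n" "k \<notin> Even n"
  shows "(\<Sum>u\<in>Even n. gval b (u \<bullet> k)) = 0"
proof -
  obtain w where w: "w \<in> Even n" "w \<bullet> k = 2" using not_Even_witness[OF assms] .
  have "(\<Sum>u\<in>Even n. gval b (u \<bullet> k)) = (\<Sum>u\<in>Even n. gval b ((u + w) \<bullet> k))"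
    by (rule sum_shift_Even[OF w(1), symmetric])
  also have "\<dots> = - (\<Sum>u\<in>Even n. gval b (u \<bullet> k))"
    using w(2) assms(1) by (simp add: add_dot[where n = n] Even_D w(1) gval_add_2 sum_negf)
  finally show ?thesis by simp
qed

section \<open>Representatives of the non-even vectors up to sign\<close>

lemma OmegaD: "h \<in> Omega n \<Longrightarrow> h \<in> Delta n"
  by (simp add: Omega_def)

lemma Omega_not_Even: "h \<in> Omega n \<Longrightarrow> h \<notin> Even n"
  by (auto simp: Omega_def Even_def)

lemma Omega_minus: "h \<in> Omega n \<Longrightarrow> - h \<notin> Omega n"
proof
  assume h: "h \<in> Omega n" and m: "- h \<in> Omega n"
  obtain i where i: "i < n" "h $ i = 1" "\<not> z4_even (h $ i)" "\<forall>j<i. z4_even (h $ j)"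
    using h by (auto simp: Omega_def)
  obtain k where k: "k < n" "(- h) $ k = 1" "\<not> z4_even ((- h) $ k)" "\<forall>j<k. z4_even ((- h) $ j)"
    using m by (auto simp: Omega_def)
  have "dim_vec h = n" using OmegaD[OF h] by simp
  then have neg: "(- h) $ j = - (h $ j)" if "j < n" for j using that by simp
  have k': "- (h $ k) = 1" "\<not> z4_even (h $ k)" "\<forall>j<k. z4_even (h $ j)"
  proof -
    show "- (h $ k) = 1" using k(2) neg[OF k(1)] by simp
    show "\<not> z4_even (h $ k)" using k(3) neg[OF k(1)] z4_even_minus by metis
    show "\<forall>j<k. z4_even (h $ j)"
    proof (intro allI impI)
      fix j assume j: "j < k"
      then show "z4_even (h $ j)" using k(1,4) neg[of j] z4_even_minus[of "h $ j"] by (metis order.strict_trans)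
    qed
  qed
  have "i = k" using i k' by (metis linorder_neqE_nat)
  then show False using i k' by simp
qed

lemma not_Even_Omega:
  assumes "k \<in> Delta n" "k \<notin> Even n"
  shows "k \<in> Omega n \<or> - k \<in> Omega n"
proof -
  define i where "i = (LEAST i. i < n \<and> \<not> z4_even (k $ i))"
  have "\<exists>i. i < n \<and> \<not> z4_even (k $ i)" using assms by (auto simp: Even_def)
  then have i: "i < n \<and> \<not> z4_even (k $ i)" unfolding i_def by (rule LeastI_ex)
  have l: "z4_even (k $ j)" if "j < i" for j
    using not_less_Least[of j "\<lambda>i. i < n \<and> \<not> z4_even (k $ i)"] that i unfolding i_def by auto
  have "k $ i = 1 \<or> k $ i = 3"
    using i by (cases "k $ i" rule: z4_exhaust) (auto simp: z4_even_def)
  then show ?thesis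
  proof
    assume "k $ i = 1"
    then have "k \<in> Omega n" using assms(1) i l by (auto simp: Omega_def)
    then show ?thesis by simp
  next
    assume "k $ i = 3"
    then have "(- k) $ i = 1" using i assms(1) by (simp add: Delta_def)
    moreover have "z4_even ((- k) $ j)" if "j < i" for j
      using l[OF that] that i assms(1) by (simp add: Delta_def)
    moreover have "\<not> z4_even ((- k) $ i)" using i assms(1) by (simp add: Delta_def)
    ultimately have "- k \<in> Omega n" using assms(1) i by (auto simp: Omega_def)
    then show ?thesis by simp
  qed
qed

lemma minus_minus_vec: "- (- k) = k" for k :: "z4 vec"
  by (intro eq_vecI) auto

lemma minus_Even: "k \<in> Even n \<Longrightarrow> - k \<in> Even n"
  by (auto simp: Even_def Delta_def)

lemma finite_Omega [simp]: "finite (Omega n)"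
  by (rule finite_subset[OF _ finite_Delta[of n]]) (auto dest: OmegaD)

text \<open>\<open>Omega n\<close> contains exactly one of \<open>k\<close> and \<open>- k\<close>
  for each non-even \<open>k\<close>, since negation turns a first odd entry 1 into 3.\<close>

lemma sum_not_Even:
  fixes f :: "z4 vec \<Rightarrow> real"
  shows "(\<Sum>k\<in>Delta n - Even n. f k) = (\<Sum>h\<in>Omega n. f h + f (- h))"
proof -
  have eq: "Delta n - Even n = Omega n \<union> uminus ` Omega n"
  proof (intro equalityI subsetI)
    fix k assume "k \<in> Delta n - Even n"
    then show "k \<in> Omega n \<union> uminus ` Omega n"
      using not_Even_Omega[of k n] minus_minus_vec[of k] by (metis DiffE UnI1 UnI2 imageI)
  next
    fix k assume "k \<in> Omega n \<union> uminus ` Omega n"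
    then show "k \<in> Delta n - Even n"
      using OmegaD Omega_not_Even minus_Even minus_minus_vec Delta_closed(3)
      by (metis DiffI UnE image_iff)
  qed
  have disj: "Omega n \<inter> uminus ` Omega n = {}"
    using Omega_minus by blast
  have inj: "inj_on uminus (Omega n)"
    by (rule inj_onI) (metis minus_minus_vec)
  show ?thesis
    unfolding eq by (simp add: sum.union_disjoint disj sum.reindex[OF inj] sum.distrib)
qed

section \<open>Columns and row sums of the design of all of \<open>Omega\<close>\<close>

definition col_entry :: "z4 vec \<Rightarrow> z4 vec \<times> nat \<Rightarrow> real" where
  "col_entry u c = gval (snd c) (u \<bullet> fst c)"

lemma col_entry_square [simp]: "col_entry u c * col_entry u c = 1"
  by (simp add: col_entry_def)

lemma col_entry_cases: "col_entry u c = 1 \<or> col_entry u c = - 1"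
  by (simp add: col_entry_def gval_cases)

lemma sum_pairs: "(\<Sum>c\<in>A \<times> {1, 2 :: nat}. f c) = (\<Sum>h\<in>A. f (h, 1) + f (h, 2))"
  using sum.cartesian_product[of "\<lambda>h b. f (h, b)" "{1, 2}" A] by simp

definition full_row_sum :: "nat \<Rightarrow> z4 vec \<Rightarrow> real" where
  "full_row_sum n u = (if u = 0\<^sub>v n then 4 ^ n else 0) - (if u \<in> Even n then 2 ^ n else 0)"

text \<open>Negating the vector exchanges the two columns of its pair, so all columns together
  become \<open>gval 1\<close> taken over all non-even vectors. This is the complete sum minus the
  sum over the even vectors, both known from translation.\<close>

lemma sum_col_entry_Omega:
  assumes "u \<in> Delta n"
  shows "(\<Sum>c\<in>Omega n \<times> {1, 2}. col_entry u c) = full_row_sum n u"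
proof -
  have comm: "u \<bullet> k = k \<bullet> u" if "k \<in> Delta n" for k
    using assms that by (auto simp: Delta_def comm_scalar_prod)
  have "(\<Sum>c\<in>Omega n \<times> {1, 2}. col_entry u c) = (\<Sum>h\<in>Omega n. gval 1 (u \<bullet> h) + gval 1 (u \<bullet> (- h)))"
    unfolding sum_pairs
    by (rule sum.cong) (use assms OmegaD gval_minus in \<open>auto simp: col_entry_def dot_minus\<close>)
  also have "\<dots> = (\<Sum>k\<in>Delta n - Even n. gval 1 (u \<bullet> k))"
    by (simp only: sum_not_Even)
  also have "\<dots> = (\<Sum>k\<in>Delta n. gval 1 (k \<bullet> u)) - (\<Sum>k\<in>Even n. gval 1 (k \<bullet> u))"
    using comm Even_D by (simp add: sum_diff Even_subset)
  also have "(\<Sum>k\<in>Even n. gval 1 (k \<bullet> u)) = (if u \<in> Even n then 2 ^ n else 0)"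
  proof (cases "u \<in> Even n")
    case True
    then have "(\<Sum>k\<in>Even n. gval 1 (k \<bullet> u)) = (\<Sum>k\<in>Even n. 1)"
      by (intro sum.cong) (auto simp: Even_dot_Even)
    then show ?thesis using True by (simp add: card_Even)
  next
    case False
    then show ?thesis using sum_gval_Even[OF assms False] by simp
  qed
  finally show ?thesis using sum_gval_Delta[OF assms] by (simp add: full_row_sum_def)
qed

lemma card_Omega: "card (Omega n) = (4 ^ n - 2 ^ n) div 2"
proof -
  have "real (card (Delta n - Even n)) = 2 * real (card (Omega n))"
    using sum_not_Even[of "\<lambda>_. 1" n] by simp
  then have "card (Delta n - Even n) = 2 * card (Omega n)" by linarith
  then show ?thesis
    by (simp add: card_Diff_subset Even_subset card_Delta card_Even)
qed

lemma sum_gval_mult: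
  assumes "k \<in> Delta n" "h \<in> Delta n" "k + h \<noteq> 0\<^sub>v n" "k - h \<noteq> 0\<^sub>v n"
  shows "(\<Sum>u\<in>Delta n. gval b (u \<bullet> k) * gval b' (u \<bullet> h)) = 0"
proof -
  obtain p q r t where "\<And>x y. gval b x * gval b' y
      = (p * gval 1 (x + y) + q * gval 2 (x + y) + r * gval 1 (x - y) + t * gval 2 (x - y)) / 2"
    using gval_mult_signs[of b b'] by metis
  then have "(\<Sum>u\<in>Delta n. gval b (u \<bullet> k) * gval b' (u \<bullet> h)) =
      (\<Sum>u\<in>Delta n. (p * gval 1 (u \<bullet> (k + h)) + q * gval 2 (u \<bullet> (k + h))
        + r * gval 1 (u \<bullet> (k - h)) + t * gval 2 (u \<bullet> (k - h))) / 2)"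
    using assms by (intro sum.cong) (auto simp: dot_add dot_diff)
  also have "\<dots> = (p * (\<Sum>u\<in>Delta n. gval 1 (u \<bullet> (k + h))) + q * (\<Sum>u\<in>Delta n. gval 2 (u \<bullet> (k + h)))
        + r * (\<Sum>u\<in>Delta n. gval 1 (u \<bullet> (k - h))) + t * (\<Sum>u\<in>Delta n. gval 2 (u \<bullet> (k - h)))) / 2"
    by (simp only: sum.distrib sum_distrib_left sum_divide_distrib[symmetric])
  also have "\<dots> = 0" using assms by (simp add: sum_gval_Delta)
  finally show ?thesis .
qed

lemma add_eq_0_iff_vec: "k \<in> Delta n \<Longrightarrow> h \<in> Delta n \<Longrightarrow> k + h = 0\<^sub>v n \<longleftrightarrow> k = - h"
  for k h :: "z4 vec"
  by (auto simp: Delta_def vec_eq_iff eq_neg_iff_add_eq_0)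

lemma diff_eq_0_iff_vec: "k \<in> Delta n \<Longrightarrow> h \<in> Delta n \<Longrightarrow> k - h = 0\<^sub>v n \<longleftrightarrow> k = h"
  for k h :: "z4 vec"
  by (auto simp: Delta_def vec_eq_iff)

lemma col_entry_orthogonal:
  assumes "c \<in> Omega n \<times> {1, 2}" "c' \<in> Omega n \<times> {1, 2}"
  shows "(\<Sum>u\<in>Delta n. col_entry u c * col_entry u c') = (if c = c' then 4 ^ n else 0)"
proof -
  obtain h b h' b' where c: "c = (h, b)" "c' = (h', b')" by (metis surj_pair)
  have h: "h \<in> Omega n" "h' \<in> Omega n" "b \<in> {1, 2}" "b' \<in> {1, 2}" using assms c by auto
  have sum: "h + h' \<noteq> 0\<^sub>v n"
    using h Omega_minus[of h' n] by (auto simp: add_eq_0_iff_vec OmegaD)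
  consider "h \<noteq> h'" | "h = h'" "b = b'" | "h = h'" "b \<noteq> b'" by blast
  then show ?thesis
  proof cases
    case 1
    then have "h - h' \<noteq> 0\<^sub>v n" using h by (auto simp: diff_eq_0_iff_vec OmegaD)
    then show ?thesis
      using sum_gval_mult[of h n h' b b'] sum h 1 c by (auto simp: col_entry_def OmegaD)
  next
    case 2
    then show ?thesis using c by (simp add: card_Delta)
  next
    case 3
    \<comment> \<open>Here \<open>h - h'\<close> is zero and \<open>sum_gval_mult\<close> does not
      apply. For the two different columns of one pair, the difference terms in the product formula
      cancel at 0, leaving only the sum \<open>h + h'\<close>.\<close>
    have gg: "gval b x * gval b' x = (gval 1 (x + x) + gval 2 (x + x)) / 2" for x
      using 3 h(3,4) gval_mult(3)[of x x] gval_mult(4)[of x x]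
      by (auto simp del: One_nat_def)
    have "(\<Sum>u\<in>Delta n. col_entry u c * col_entry u c') =
        (\<Sum>u\<in>Delta n. (gval 1 (u \<bullet> (h + h')) + gval 2 (u \<bullet> (h + h'))) / 2)"
      using h 3 c gg by (intro sum.cong) (auto simp: col_entry_def dot_add OmegaD)
    also have "\<dots> = ((\<Sum>u\<in>Delta n. gval 1 (u \<bullet> (h + h'))) + (\<Sum>u\<in>Delta n. gval 2 (u \<bullet> (h + h')))) / 2"
      by (simp only: sum.distrib sum_divide_distrib[symmetric])
    also have "\<dots> = 0" using sum h by (simp add: sum_gval_Delta OmegaD)
    finally show ?thesis using 3 c by simp
  qed
qed

section \<open>Generating polynomials\<close>

lemma coeff_prod_linear:
  fixes f :: "'c \<Rightarrow> 'a :: comm_ring_1"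
  assumes "finite A"
  shows "coeff (\<Prod>c\<in>A. [:1, f c:]) k = (\<Sum>H | H \<subseteq> A \<and> card H = k. \<Prod>c\<in>H. f c)"
proof -
  have "(\<Prod>c\<in>A. [:1, f c:]) = (\<Prod>c\<in>A. monom (f c) 1 + 1)"
    by (intro prod.cong) (auto simp: monom_altdef one_pCons)
  also have "\<dots> = (\<Sum>H\<in>Pow A. (\<Prod>c\<in>H. monom (f c) 1) * (\<Prod>c\<in>A - H. 1))"
    by (rule prod_add[OF assms])
  also have "\<dots> = (\<Sum>H\<in>Pow A. monom (\<Prod>c\<in>H. f c) (card H))"
  proof (rule sum.cong)
    fix H assume "H \<in> Pow A"
    then have "finite H" using assms finite_subset by blast
    then show "(\<Prod>c\<in>H. monom (f c) 1) * (\<Prod>c\<in>A - H. 1) = monom (\<Prod>c\<in>H. f c) (card H)"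
      by (induction H rule: finite_induct) (simp_all add: mult_monom)
  qed simp
  finally have "coeff (\<Prod>c\<in>A. [:1, f c:]) k = (\<Sum>H\<in>Pow A. if card H = k then \<Prod>c\<in>H. f c else 0)"
    by (simp add: coeff_sum)
  also have "\<dots> = (\<Sum>H | H \<in> Pow A \<and> card H = k. \<Prod>c\<in>H. f c)"
    using assms by (intro sum.inter_filter[symmetric]) simp
  finally show ?thesis by simp
qed

lemma smult_sum_right: "smult a (\<Sum>i\<in>A. f i) = (\<Sum>i\<in>A. smult a (f i))"
  by (induction A rule: infinite_finite_induct) (simp_all add: smult_add_right)

definition gen_poly :: "('r, 'c) design \<Rightarrow> real poly" where
  "gen_poly D = smult (1 / (real (card (runs D)))\<^sup>2)
     (\<Sum>u\<in>runs D. \<Sum>w\<in>runs D. \<Prod>c\<in>factors D. [:1, entry D u c * entry D w c:])"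

text \<open>Squaring a mean produces a double sum over runs and absorbs the absolute value. Summing
  the products over all column sets of size \<open>k\<close> then gives an elementary symmetric
  function, so \<open>gen_poly\<close> is the wordlength enumerator.\<close>

lemma coeff_gen_poly:
  fixes D :: "('r, 'c) design"
  assumes "finite (factors D)"
  shows "coeff (gen_poly D) k = wordlength D k"
proof -
  let ?X = "\<lambda>H u. \<Prod>c\<in>H. entry D u c"
  have "wordlength D k = (\<Sum>H | H \<subseteq> factors D \<and> card H = k.
      1 / (real (card (runs D)))\<^sup>2 * (\<Sum>u\<in>runs D. \<Sum>w\<in>runs D. ?X H u * ?X H w))"
    unfolding wordlength_def rho_def
    by (intro sum.cong refl) (simp add: power_divide power2_eq_square sum_product)
  also have "\<dots> = 1 / (real (card (runs D)))\<^sup>2 * (\<Sum>u\<in>runs D. \<Sum>w\<in>runs D.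
      \<Sum>H | H \<subseteq> factors D \<and> card H = k. ?X H u * ?X H w)"
  proof -
    have swap: "(\<Sum>H\<in>\<H>. \<Sum>u\<in>R. \<Sum>w\<in>R. F H u w) = (\<Sum>u\<in>R. \<Sum>w\<in>R. \<Sum>H\<in>\<H>. F H u w)"
      for \<H> :: "'c set set" and R :: "'r set" and F :: "'c set \<Rightarrow> 'r \<Rightarrow> 'r \<Rightarrow> real"
      by (subst sum.swap, rule sum.cong[OF refl], rule sum.swap)
    show ?thesis by (subst swap[symmetric]) (rule sum_distrib_left[symmetric])
  qed
  finally show ?thesis
    by (simp add: gen_poly_def coeff_sum coeff_prod_linear[OF assms] prod.distrib)
qed

lemma prod_pairs: "(\<Prod>c\<in>A \<times> {1, 2 :: nat}. f c) = (\<Prod>h\<in>A. f (h, 1) * f (h, 2))"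
  using prod.cartesian_product[of "\<lambda>h b. f (h, b)" "{1, 2}" A] by simp

lemma prod_factors_delete:
  fixes F :: "'h \<times> nat \<Rightarrow> 'a :: comm_monoid_mult"
  assumes "finite T" "g \<in> T" "b \<in> {1, 2}"
  shows "(\<Prod>c\<in>T \<times> {1, 2} - {(g, b)}. F c) =
    (\<Prod>h\<in>T - {g}. F (h, 1) * F (h, 2)) * F (g, 3 - b)"
proof -
  have "T \<times> {1, 2} - {(g, b)} = insert (g, 3 - b) ((T - {g}) \<times> {1, 2})"
    using assms(2,3) by auto
  then show ?thesis using assms
    by (simp add: prod_pairs mult.commute del: One_nat_def)
qed

text \<open>Only the column left over from the incomplete pair is not a function of the difference \<open>u - w\<close>;
  averaging over \<open>w\<close> replaces it by the mean of the two columns of its pair.\<close>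

lemma gen_poly_QC:
  assumes T: "T \<subseteq> Omega n" and g: "g \<in> T" and b: "b \<in> {1, 2}"
  shows "gen_poly (delete_factor (g, b) (even_design n T)) =
    smult (1 / (2 * 4 ^ n)) (\<Sum>d\<in>Delta n. \<Sum>b\<in>{1, 2}. \<Prod>c\<in>T \<times> {1, 2} - {(g, b)}. [:1, col_entry d c:])"
proof -
  define P where "P d = (\<Prod>h\<in>T - {g}. [:1, gval 1 (d \<bullet> h):] * [:1, gval 2 (d \<bullet> h):])" for d
  define b' where "b' = 3 - b"
  have TD: "h \<in> Delta n" if "h \<in> T" for h using that T OmegaD by blast
  have finT: "finite T" using T finite_subset finite_Omega by blast
  obtain i where i: "i < n" "g $ i = 1" using T g by (auto simp: Omega_def)
  have entry: "entry (even_design n T) u c = col_entry u c" for u c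
    by (auto simp: even_design_def col_entry_def gval_def split: prod.split)
  have pair: "[:1, gval 1 (u \<bullet> h) * gval 1 (w \<bullet> h):] * [:1, gval 2 (u \<bullet> h) * gval 2 (w \<bullet> h):]
      = [:1, gval 1 ((u - w) \<bullet> h):] * [:1, gval 2 ((u - w) \<bullet> h):]"
    if "u \<in> Delta n" "w \<in> Delta n" "h \<in> T" for u w h
    using gval_pair_diff[of "u \<bullet> h" "w \<bullet> h"] gval_pair_diff_prod[of "u \<bullet> h" "w \<bullet> h"] that TD
    by (simp add: diff_dot add.commute mult.commute)
  have "(\<Prod>c\<in>T \<times> {1, 2} - {(g, b)}. [:1, col_entry u c * col_entry w c:]) =
      P (u - w) * [:1, gval b' (u \<bullet> g) * gval b' (w \<bullet> g):]" if "u \<in> Delta n" "w \<in> Delta n" for u w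
  proof -
    have "(\<Prod>h\<in>T - {g}. [:1, col_entry u (h, 1) * col_entry w (h, 1):] * [:1, col_entry u (h, 2) * col_entry w (h, 2):])
        = P (u - w)"
      unfolding P_def col_entry_def fst_conv snd_conv
      by (rule prod.cong[OF refl], rule pair) (use that in auto)
    then show ?thesis
      unfolding prod_factors_delete[OF finT g b] b'_def by (simp only: col_entry_def fst_conv snd_conv)
  qed
  then have "(\<Sum>u\<in>Delta n. \<Sum>w\<in>Delta n. \<Prod>c\<in>T \<times> {1, 2} - {(g, b)}. [:1, col_entry u c * col_entry w c:]) =
      (\<Sum>u\<in>Delta n. \<Sum>w\<in>Delta n. P (u - w) * [:1, gval b' (u \<bullet> g) * gval b' (w \<bullet> g):])"
    by simp
  also have "\<dots> = (\<Sum>w\<in>Delta n. \<Sum>u\<in>Delta n. P (u - w) * [:1, gval b' (u \<bullet> g) * gval b' (w \<bullet> g):])"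
    by (rule sum.swap)
  also have "\<dots> = (\<Sum>w\<in>Delta n. \<Sum>d\<in>Delta n. P d * [:1, gval b' ((d + w) \<bullet> g) * gval b' (w \<bullet> g):])"
  proof (rule sum.cong[OF refl])
    fix w assume w: "w \<in> Delta n"
    show "(\<Sum>u\<in>Delta n. P (u - w) * [:1, gval b' (u \<bullet> g) * gval b' (w \<bullet> g):]) =
        (\<Sum>d\<in>Delta n. P d * [:1, gval b' ((d + w) \<bullet> g) * gval b' (w \<bullet> g):])"
      by (rule sum.reindex_bij_witness[where i = "\<lambda>u. u + w" and j = "\<lambda>u. u - w"])
        (simp_all add: vec_shift_cancel[where n = n] w)
  qed
  also have "\<dots> = (\<Sum>d\<in>Delta n. \<Sum>w\<in>Delta n. P d * [:1, gval b' ((d + w) \<bullet> g) * gval b' (w \<bullet> g):])"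
    by (rule sum.swap)
  also have "\<dots> = (\<Sum>d\<in>Delta n. smult (4 ^ n / 2) (P d * ([:1, gval 1 (d \<bullet> g):] + [:1, gval 2 (d \<bullet> g):])))"
  proof (rule sum.cong[OF refl])
    fix d assume d: "d \<in> Delta n"
    define q where "q w = gval b' ((d + w) \<bullet> g) * gval b' (w \<bullet> g)" for w
    \<comment> \<open>Each \<open>w\<close> is combined with its translate by the unit vector at an
      entry 1 of \<open>g\<close>. This raises both dot products with \<open>g\<close> by 1, as
      \<open>gval_shift_1\<close> requires.\<close>
    have "2 * (\<Sum>w\<in>Delta n. q w) = (\<Sum>w\<in>Delta n. q w + q (w + unit_vec n i))"
      by (simp add: sum.distrib sum_shift)
    also have "\<dots> = (\<Sum>w\<in>Delta n. gval 1 (d \<bullet> g) + gval 2 (d \<bullet> g))"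
    proof (rule sum.cong[OF refl])
      fix w assume w: "w \<in> Delta n"
      have "(d + (w + unit_vec n i)) \<bullet> g = (d + w) \<bullet> g + 1" "(w + unit_vec n i) \<bullet> g = w \<bullet> g + 1"
        using d w i TD[OF g] by (simp_all add: add_dot dot_unit add.assoc)
      then show "q w + q (w + unit_vec n i) = gval 1 (d \<bullet> g) + gval 2 (d \<bullet> g)"
        using gval_shift_1[of b' "(d + w) \<bullet> g" "w \<bullet> g"] d w TD[OF g]
        unfolding q_def by (simp add: add_dot add.assoc)
    qed
    finally have q: "(\<Sum>w\<in>Delta n. q w) = 4 ^ n / 2 * (gval 1 (d \<bullet> g) + gval 2 (d \<bullet> g))"
      by (simp add: card_Delta)
    have lin: "(\<Sum>w\<in>A. [:1, r w:]) = [:real (card A), sum r A:]" if "finite A" for A and r :: "z4 vec \<Rightarrow> real"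
      using that by (induction A rule: finite_induct) auto
    have "(\<Sum>w\<in>Delta n. P d * [:1, q w:]) = P d * [:4 ^ n, \<Sum>w\<in>Delta n. q w:]"
      unfolding sum_distrib_left[symmetric] by (simp add: lin card_Delta)
    also have "\<dots> = smult (4 ^ n / 2) (P d * ([:1, gval 1 (d \<bullet> g):] + [:1, gval 2 (d \<bullet> g):]))"
      unfolding mult_smult_right[symmetric] q by (simp add: algebra_simps)
    finally show "(\<Sum>w\<in>Delta n. P d * [:1, gval b' ((d + w) \<bullet> g) * gval b' (w \<bullet> g):]) =
        smult (4 ^ n / 2) (P d * ([:1, gval 1 (d \<bullet> g):] + [:1, gval 2 (d \<bullet> g):]))"
      unfolding q_def .
  qed
  also have "\<dots> = smult (4 ^ n / 2) (\<Sum>d\<in>Delta n. \<Sum>b\<in>{1, 2}. \<Prod>c\<in>T \<times> {1, 2} - {(g, b)}. [:1, col_entry d c:])"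
  proof -
    have "(\<Sum>b\<in>{1, 2 :: nat}. \<Prod>c\<in>T \<times> {1, 2} - {(g, b)}. [:1, col_entry d c:]) =
        P d * ([:1, gval 1 (d \<bullet> g):] + [:1, gval 2 (d \<bullet> g):])" for d
    proof -
      have "(\<Sum>b\<in>{1, 2 :: nat}. \<Prod>c\<in>T \<times> {1, 2} - {(g, b)}. [:1, col_entry d c:]) =
        (\<Sum>b\<in>{1, 2 :: nat}. P d * [:1, gval (3 - b) (d \<bullet> g):])"
      proof (rule sum.cong[OF refl])
        fix b :: nat assume b: "b \<in> {1, 2}"
        show "(\<Prod>c\<in>T \<times> {1, 2} - {(g, b)}. [:1, col_entry d c:]) = P d * [:1, gval (3 - b) (d \<bullet> g):]"
          unfolding prod_factors_delete[OF finT g b] P_def col_entry_def fst_conv snd_conv ..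
      qed
      also have "\<dots> = P d * [:1, gval 2 (d \<bullet> g):] + P d * [:1, gval 1 (d \<bullet> g):]"
        by (simp add: numeral_2_eq_2 numeral_3_eq_3)
      finally show ?thesis by (simp only: distrib_left add.commute)
    qed
    then show ?thesis by (simp add: smult_sum_right)
  qed
  finally have "(\<Sum>u\<in>Delta n. \<Sum>w\<in>Delta n. \<Prod>c\<in>T \<times> {1, 2} - {(g, b)}. [:1, col_entry u c * col_entry w c:]) =
    smult (4 ^ n / 2) (\<Sum>d\<in>Delta n. \<Sum>b\<in>{1, 2}. \<Prod>c\<in>T \<times> {1, 2} - {(g, b)}. [:1, col_entry d c:])" .
  then show ?thesis
    unfolding gen_poly_def delete_factor_def
    by (simp add: entry) (simp add: even_design_def card_Delta power2_eq_square mult.commute)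
qed

section \<open>The third entry of the wordlength pattern\<close>

text \<open>Newton's identities for signs: every odd power sum equals the plain sum, and every even
  power sum equals the number of signs.\<close>

lemma coeff_prod_signs:
  fixes e :: "'c \<Rightarrow> real"
  assumes "finite A" "\<And>c. c \<in> A \<Longrightarrow> e c * e c = 1"
  defines "p \<equiv> \<Prod>c\<in>A. [:1, e c:]"
  shows "coeff p 0 = 1" "coeff p 1 = sum e A" "coeff p 2 = ((sum e A)\<^sup>2 - real (card A)) / 2"
    "coeff p 3 = ((sum e A) ^ 3 - (3 * real (card A) - 2) * sum e A) / 6"
proof -
  have "coeff p 0 = 1 \<and> coeff p 1 = sum e A \<and> coeff p 2 = ((sum e A)\<^sup>2 - real (card A)) / 2 \<and>
      coeff p 3 = ((sum e A) ^ 3 - (3 * real (card A) - 2) * sum e A) / 6"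
    using assms(1,2) unfolding p_def
  proof (induction A rule: finite_induct)
    case (insert x A)
    define P where "P = (\<Prod>c\<in>A. [:1, e c:])"
    define S where "S = sum e A"
    have IH: "coeff P 0 = 1" "coeff P 1 = S" "coeff P 2 = (S\<^sup>2 - real (card A)) / 2"
      "coeff P 3 = (S ^ 3 - (3 * real (card A) - 2) * S) / 6"
      using insert by (auto simp: P_def S_def)
    have eq: "(\<Prod>c\<in>insert x A. [:1, e c:]) = P + pCons 0 (smult (e x) P)"
      using insert by (simp add: P_def)
    have S: "sum e (insert x A) = e x + S" "real (card (insert x A)) = real (card A) + 1"
      using insert by (simp_all add: S_def)
    have x: "e x * e x = 1" using insert by simp
    have x2: "(e x)\<^sup>2 = 1" "(e x) ^ 3 = e x"
      using x by (simp_all add: power2_eq_square power3_eq_cube)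
    have c: "coeff (pCons 0 (smult (e x) P)) 0 = 0" "coeff (pCons 0 (smult (e x) P)) 1 = e x * coeff P 0"
      "coeff (pCons 0 (smult (e x) P)) 2 = e x * coeff P 1" "coeff (pCons 0 (smult (e x) P)) 3 = e x * coeff P 2"
      by (simp_all add: numeral_2_eq_2 numeral_3_eq_3)
    have 2: "((e x + S)\<^sup>2 - (real (card A) + 1)) / 2 = (S\<^sup>2 - real (card A)) / 2 + e x * S"
      by (simp add: power2_sum x2 field_simps)
    have "(e x + S) ^ 3 = (e x) ^ 3 + 3 * (e x)\<^sup>2 * S + 3 * e x * S\<^sup>2 + S ^ 3"
      by (simp add: power2_eq_square power3_eq_cube algebra_simps)
    then have "(e x + S) ^ 3 = e x + 3 * S + 3 * e x * S\<^sup>2 + S ^ 3"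
      by (simp add: x2)
    then have 3: "((e x + S) ^ 3 - (3 * (real (card A) + 1) - 2) * (e x + S)) / 6 =
        (S ^ 3 - (3 * real (card A) - 2) * S) / 6 + e x * ((S\<^sup>2 - real (card A)) / 2)"
      by (simp add: field_simps)
    show ?case
      unfolding eq S coeff_add c IH
      by (intro conjI) (simp, simp, rule 2[symmetric], rule 3[symmetric])
  qed simp
  then show "coeff p 0 = 1" "coeff p 1 = sum e A" "coeff p 2 = ((sum e A)\<^sup>2 - real (card A)) / 2"
    "coeff p 3 = ((sum e A) ^ 3 - (3 * real (card A) - 2) * sum e A) / 6" by blast+
qed

lemma full_row_sum_0: "full_row_sum n (0\<^sub>v n) = 4 ^ n - 2 ^ n"
  by (simp add: full_row_sum_def)

lemma sum_full_row_sum: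
  "(\<Sum>u\<in>Delta n. full_row_sum n u * F u) = 4 ^ n * F (0\<^sub>v n) - 2 ^ n * (\<Sum>u\<in>Even n. F u)"
proof -
  have "(\<Sum>u\<in>Delta n. full_row_sum n u * F u) =
    (\<Sum>u\<in>Delta n. (if u = 0\<^sub>v n then 4 ^ n * F u else 0) - (if u \<in> Even n then 2 ^ n * F u else 0))"
    by (intro sum.cong) (auto simp: full_row_sum_def algebra_simps)
  also have "\<dots> = 4 ^ n * F (0\<^sub>v n) - (\<Sum>u\<in>Delta n \<inter> Even n. 2 ^ n * F u)"
    by (simp add: sum_subtractf sum.inter_restrict)
  also have "Delta n \<inter> Even n = Even n" using Even_subset by blast
  finally show ?thesis by (simp add: sum_distrib_left)
qed

text \<open>Terms with two factors \<open>full_row_sum\<close> are treated by applying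
  \<open>sum_full_row_sum\<close> to the first one; this leaves a sum over the even vectors that
  still contains the second.\<close>

lemma sum_full_row_sum_Even:
  "(\<Sum>u\<in>Even n. full_row_sum n u * F u) = 4 ^ n * F (0\<^sub>v n) - 2 ^ n * (\<Sum>u\<in>Even n. F u)"
proof -
  have "(\<Sum>u\<in>Even n. full_row_sum n u * F u) =
    (\<Sum>u\<in>Even n. (if u = 0\<^sub>v n then 4 ^ n * F u else 0) - 2 ^ n * F u)"
    by (intro sum.cong) (auto simp: full_row_sum_def algebra_simps)
  then show ?thesis by (simp add: sum_subtractf sum_distrib_left)
qed

lemma col_entry_0 [simp]: "fst c \<in> Delta n \<Longrightarrow> col_entry (0\<^sub>v n) c = 1"
  by (simp add: col_entry_def)

lemma sum_col_entry: "c \<in> Omega n \<times> {1, 2} \<Longrightarrow> (\<Sum>u\<in>Delta n. col_entry u c) = 0"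
  using Omega_not_Even[of "fst c" n] Even_0[of n] by (auto simp: col_entry_def sum_gval_Delta OmegaD)

lemma sum_col_entry_Even: "c \<in> Omega n \<times> {1, 2} \<Longrightarrow> (\<Sum>u\<in>Even n. col_entry u c) = 0"
  by (auto simp: col_entry_def sum_gval_Even OmegaD Omega_not_Even)

text \<open>Dot products with an even \<open>u\<close> are even, and there both columns of a pair
  coincide and are multiplicative. The product is thus one character of the group of even vectors,
  trivial exactly when the two generating vectors are congruent modulo 2.\<close>

lemma col_entry_orthogonal_Even:
  assumes "c \<in> Omega n \<times> {1, 2}" "c' \<in> Omega n \<times> {1, 2}"
  shows "(\<Sum>u\<in>Even n. col_entry u c * col_entry u c') = (if fst c + fst c' \<in> Even n then 2 ^ n else 0)"
proof -
  have D: "fst c \<in> Delta n" "fst c' \<in> Delta n" using assms by (auto simp: OmegaD)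
  have gg: "gval b x * gval b' y = gval 1 (x + y)" if "z4_even x" "z4_even y" for b b' x y
    using that by (auto simp: z4_even_def gval_def gray_def)
  have eq: "(\<Sum>u\<in>Even n. col_entry u c * col_entry u c') = (\<Sum>u\<in>Even n. gval 1 (u \<bullet> (fst c + fst c')))"
    unfolding col_entry_def
    by (intro sum.cong refl, subst dot_add[where n = n], use D in \<open>auto simp: Even_D gg Even_dot_even[where n = n]\<close>)
  show ?thesis
  proof (cases "fst c + fst c' \<in> Even n")
    case True
    then have "(\<Sum>u\<in>Even n. gval 1 (u \<bullet> (fst c + fst c'))) = (\<Sum>u\<in>Even n. 1)"
      by (intro sum.cong) (auto simp: Even_dot_Even)
    then show ?thesis using True eq by (simp add: card_Even)
  next
    case False
    then show ?thesis using eq D sum_gval_Even[of "fst c + fst c'" n 1] by simp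
  qed
qed

text \<open>Ordered pairs of columns from different classes modulo 2. Sum and difference of two
  vectors differ by an even vector, so the sum can be tested in place of the difference.\<close>

definition odd_pairs :: "nat \<Rightarrow> (z4 vec \<times> nat) set \<Rightarrow> ((z4 vec \<times> nat) \<times> (z4 vec \<times> nat)) set" where
  "odd_pairs n K = {(c, c') \<in> K \<times> K. fst c + fst c' \<notin> Even n}"

section \<open>Moments of the row sums of a set of columns\<close>

definition row_sum :: "(z4 vec \<times> nat) set \<Rightarrow> z4 vec \<Rightarrow> real" where
  "row_sum K u = (\<Sum>c\<in>K. col_entry u c)"

locale column_set =
  fixes n :: nat and K :: "(z4 vec \<times> nat) set"
  assumes K: "K \<subseteq> Omega n \<times> {1, 2}"
begin

abbreviation L :: "z4 vec \<Rightarrow> real" where "L \<equiv> row_sum K"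

lemma finite_K [simp]: "finite K"
  using K by (rule finite_subset) simp

lemma K_Delta: "c \<in> K \<Longrightarrow> fst c \<in> Delta n"
  using K by (auto simp: OmegaD)

lemma finite_odd_pairs [simp]: "finite (odd_pairs n K)"
  by (rule finite_subset[of _ "K \<times> K"]) (auto simp: odd_pairs_def)

lemma L_0: "L (0\<^sub>v n) = card K"
  by (simp add: row_sum_def K_Delta)

lemma sum_L: "(\<Sum>u\<in>Delta n. L u) = 0"
  unfolding row_sum_def by (subst sum.swap, rule sum.neutral) (use K sum_col_entry in blast)

lemma sum_L_Even: "(\<Sum>u\<in>Even n. L u) = 0"
  unfolding row_sum_def by (subst sum.swap, rule sum.neutral) (use K sum_col_entry_Even in blast)

lemma L_square: "L u * L u = (\<Sum>c\<in>K. \<Sum>c'\<in>K. col_entry u c * col_entry u c')"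
  by (simp add: row_sum_def sum_product)

lemma swap_pairs: "(\<Sum>u\<in>A. \<Sum>c\<in>K. \<Sum>c'\<in>K. F u c c') = (\<Sum>c\<in>K. \<Sum>c'\<in>K. \<Sum>u\<in>A. F u c c')"
  by (subst sum.swap, rule sum.cong[OF refl], rule sum.swap)

lemma sum_L_square: "(\<Sum>u\<in>Delta n. L u * L u) = 4 ^ n * real (card K)"
proof -
  have "(\<Sum>u\<in>Delta n. L u * L u) = (\<Sum>c\<in>K. \<Sum>c'\<in>K. if c = c' then 4 ^ n else 0)"
    unfolding L_square swap_pairs
    by (intro sum.cong refl col_entry_orthogonal) (use K in auto)
  then show ?thesis by simp
qed

lemma sum_L_square_Even:
  "(\<Sum>u\<in>Even n. L u * L u) = 2 ^ n * ((real (card K))\<^sup>2 - card (odd_pairs n K))"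
proof -
  have "(\<Sum>u\<in>Even n. L u * L u) = (\<Sum>c\<in>K. \<Sum>c'\<in>K. if fst c + fst c' \<in> Even n then 2 ^ n else 0)"
    unfolding L_square swap_pairs
    by (intro sum.cong refl col_entry_orthogonal_Even) (use K in auto)
  also have "\<dots> = (\<Sum>(c, c')\<in>K \<times> K. 2 ^ n - (if (c, c') \<in> odd_pairs n K then 2 ^ n else 0))"
    unfolding sum.cartesian_product by (intro sum.cong refl) (auto simp: odd_pairs_def)
  also have "\<dots> = 2 ^ n * (real (card K))\<^sup>2 - (\<Sum>p\<in>(K \<times> K) \<inter> odd_pairs n K. 2 ^ n)"
    by (simp add: split_def sum_subtractf sum.inter_restrict[symmetric] power2_eq_square)
  also have "(K \<times> K) \<inter> odd_pairs n K = odd_pairs n K"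
    by (auto simp: odd_pairs_def)
  finally show ?thesis by (simp add: algebra_simps)
qed

text \<open>For a non-even \<open>k\<close> this function is a column of the design of all of
  \<open>Omega\<close>: directly if \<open>k\<close> lies in \<open>Omega n\<close>, and otherwise
  the other column of the pair of \<open>- k\<close>. By orthogonality at most one column of
  \<open>K\<close> contributes.\<close>

lemma inner_gval_L:
  assumes "k \<in> Delta n" "k \<notin> Even n"
  shows "\<bar>\<Sum>u\<in>Delta n. gval b (u \<bullet> k) * L u\<bar> \<le> 4 ^ n"
proof -
  obtain c' where c': "c' \<in> Omega n \<times> {1, 2}" "\<And>u. u \<in> Delta n \<Longrightarrow> gval b (u \<bullet> k) = col_entry u c'"
  proof (cases "k \<in> Omega n")
    case True
    then show thesis
      using gval_not_1[of b] by (intro that[of "(k, if b = 1 then 1 else 2)"]) (auto simp: col_entry_def)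
  next
    case False
    then have "- k \<in> Omega n" using not_Even_Omega[OF assms] by simp
    then show thesis
      using gval_not_1[of b] assms(1) gval_minus
      by (intro that[of "(- k, if b = 1 then 2 else 1)"]) (auto simp: col_entry_def dot_minus[where n = n])
  qed
  have "(\<Sum>u\<in>Delta n. gval b (u \<bullet> k) * L u) = (\<Sum>u\<in>Delta n. \<Sum>c\<in>K. col_entry u c' * col_entry u c)"
    using c'(2) by (simp add: row_sum_def sum_distrib_left)
  also have "\<dots> = (\<Sum>c\<in>K. \<Sum>u\<in>Delta n. col_entry u c' * col_entry u c)"
    by (rule sum.swap)
  also have "\<dots> = (\<Sum>c\<in>K. if c' = c then 4 ^ n else 0)"
    by (intro sum.cong refl col_entry_orthogonal c'(1)) (use K in auto)
  also have "\<bar>\<dots>\<bar> \<le> 4 ^ n" by simp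
  finally show ?thesis .
qed

lemma triple_expansion:
  assumes "c \<in> K" "c' \<in> K"
  obtains p q r t :: real where "\<bar>p\<bar> \<le> 1" "\<bar>q\<bar> \<le> 1" "\<bar>r\<bar> \<le> 1" "\<bar>t\<bar> \<le> 1"
    "(\<Sum>u\<in>Delta n. col_entry u c * col_entry u c' * L u) =
      (p * (\<Sum>u\<in>Delta n. gval 1 (u \<bullet> (fst c + fst c')) * L u)
      + q * (\<Sum>u\<in>Delta n. gval 2 (u \<bullet> (fst c + fst c')) * L u)
      + r * (\<Sum>u\<in>Delta n. gval 1 (u \<bullet> (fst c - fst c')) * L u)
      + t * (\<Sum>u\<in>Delta n. gval 2 (u \<bullet> (fst c - fst c')) * L u)) / 2"
proof -
  obtain p q r t :: real where b: "\<bar>p\<bar> \<le> 1" "\<bar>q\<bar> \<le> 1" "\<bar>r\<bar> \<le> 1" "\<bar>t\<bar> \<le> 1"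
    and gg: "\<And>x y. gval (snd c) x * gval (snd c') y
      = (p * gval 1 (x + y) + q * gval 2 (x + y) + r * gval 1 (x - y) + t * gval 2 (x - y)) / 2"
    using gval_mult_signs[of "snd c" "snd c'"] by metis
  have "(\<Sum>u\<in>Delta n. col_entry u c * col_entry u c' * L u) =
      (p * (\<Sum>u\<in>Delta n. gval 1 (u \<bullet> (fst c + fst c')) * L u)
      + q * (\<Sum>u\<in>Delta n. gval 2 (u \<bullet> (fst c + fst c')) * L u)
      + r * (\<Sum>u\<in>Delta n. gval 1 (u \<bullet> (fst c - fst c')) * L u)
      + t * (\<Sum>u\<in>Delta n. gval 2 (u \<bullet> (fst c - fst c')) * L u)) / 2"
  proof -
    have "(\<Sum>u\<in>Delta n. col_entry u c * col_entry u c' * L u) =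
      (\<Sum>u\<in>Delta n. (p * (gval 1 (u \<bullet> (fst c + fst c')) * L u) + q * (gval 2 (u \<bullet> (fst c + fst c')) * L u)
        + r * (gval 1 (u \<bullet> (fst c - fst c')) * L u) + t * (gval 2 (u \<bullet> (fst c - fst c')) * L u)) / 2)"
    proof (rule sum.cong[OF refl])
      fix u assume u: "u \<in> Delta n"
      show "col_entry u c * col_entry u c' * L u = (p * (gval 1 (u \<bullet> (fst c + fst c')) * L u) + q * (gval 2 (u \<bullet> (fst c + fst c')) * L u)
        + r * (gval 1 (u \<bullet> (fst c - fst c')) * L u) + t * (gval 2 (u \<bullet> (fst c - fst c')) * L u)) / 2"
        unfolding col_entry_def gg dot_add[OF u K_Delta[OF assms(1)] K_Delta[OF assms(2)]]
          dot_diff[OF u K_Delta[OF assms(1)] K_Delta[OF assms(2)]]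
        by (simp add: field_simps)
    qed
    then show ?thesis
      by (simp only: sum.distrib sum_distrib_left sum_divide_distrib[symmetric])
  qed
  then show thesis using that[OF b] by blast
qed

lemma diff_Even_iff: "h \<in> Delta n \<Longrightarrow> h' \<in> Delta n \<Longrightarrow> h - h' \<in> Even n \<longleftrightarrow> h + h' \<in> Even n"
  by (auto simp: Even_def Delta_def z4_even_add z4_even_diff)

text \<open>Outside \<open>odd_pairs\<close> the product of the two columns is a combination of characters of even vectors,
  which are orthogonal to all columns. In general it is half a sum of at most four columns up to sign,
  and each of them has inner product at most \<open>4 ^ n\<close> with \<open>L\<close>.\<close>

lemma triple_sum:
  assumes "c \<in> K" "c' \<in> K"
  shows "(c, c') \<notin> odd_pairs n K \<Longrightarrow> (\<Sum>u\<in>Delta n. col_entry u c * col_entry u c' * L u) = 0"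
    and "(\<Sum>u\<in>Delta n. col_entry u c * col_entry u c' * L u) \<le> 2 * 4 ^ n"
proof -
  obtain p q r t :: real where b: "\<bar>p\<bar> \<le> 1" "\<bar>q\<bar> \<le> 1" "\<bar>r\<bar> \<le> 1" "\<bar>t\<bar> \<le> 1"
    and ex: "(\<Sum>u\<in>Delta n. col_entry u c * col_entry u c' * L u) =
      (p * (\<Sum>u\<in>Delta n. gval 1 (u \<bullet> (fst c + fst c')) * L u)
      + q * (\<Sum>u\<in>Delta n. gval 2 (u \<bullet> (fst c + fst c')) * L u)
      + r * (\<Sum>u\<in>Delta n. gval 1 (u \<bullet> (fst c - fst c')) * L u)
      + t * (\<Sum>u\<in>Delta n. gval 2 (u \<bullet> (fst c - fst c')) * L u)) / 2"
    using triple_expansion[OF assms] by blast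
  have D: "fst c \<in> Delta n" "fst c' \<in> Delta n" using assms K_Delta by auto
  have zero: "(\<Sum>u\<in>Delta n. col_entry u c * col_entry u c' * L u) = 0" if "(c, c') \<notin> odd_pairs n K"
  proof -
    have E: "fst c + fst c' \<in> Even n" "fst c - fst c' \<in> Even n"
      using that assms D by (auto simp: odd_pairs_def diff_Even_iff)
    have z: "(\<Sum>u\<in>Delta n. gval b (u \<bullet> k) * L u) = 0" if k: "k \<in> Even n" for b k
    proof -
      have "(\<Sum>u\<in>Delta n. gval b (u \<bullet> k) * col_entry u d) = 0" if "d \<in> K" for d
      proof -
        have d: "fst d \<in> Delta n" "fst d \<notin> Even n" using that K by (auto simp: OmegaD Omega_not_Even)
        have "- k \<noteq> fst d" using d(2) minus_Even[OF k] by metis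
        then have "k \<noteq> - fst d" using minus_minus_vec by metis
        moreover have "k \<noteq> fst d" using d(2) k by metis
        ultimately have "k + fst d \<noteq> 0\<^sub>v n" "k - fst d \<noteq> 0\<^sub>v n"
          using d(1) Even_D[OF k] add_eq_0_iff_vec diff_eq_0_iff_vec by metis+
        then show ?thesis
          unfolding col_entry_def using d Even_D[OF k] by (intro sum_gval_mult)
      qed
      then show ?thesis
        unfolding row_sum_def sum_distrib_left by (subst sum.swap) simp
    qed
    show ?thesis unfolding ex z[OF E(1)] z[OF E(2)] by simp
  qed
  then show "(c, c') \<notin> odd_pairs n K \<Longrightarrow> (\<Sum>u\<in>Delta n. col_entry u c * col_entry u c' * L u) = 0" .
  show "(\<Sum>u\<in>Delta n. col_entry u c * col_entry u c' * L u) \<le> 2 * 4 ^ n"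
  proof (cases "(c, c') \<in> odd_pairs n K")
    case False
    then show ?thesis using zero by simp
  next
    case True
    then have E: "fst c + fst c' \<notin> Even n" "fst c - fst c' \<notin> Even n"
      using assms D by (auto simp: odd_pairs_def diff_Even_iff)
    have le: "x * y \<le> 4 ^ n" if "\<bar>x\<bar> \<le> 1" "\<bar>y\<bar> \<le> 4 ^ n" for x y :: real
    proof -
      have "\<bar>x * y\<bar> \<le> 1 * 4 ^ n" unfolding abs_mult using that by (intro mult_mono) auto
      then show ?thesis by simp
    qed
    have "p * (\<Sum>u\<in>Delta n. gval 1 (u \<bullet> (fst c + fst c')) * L u)
      + q * (\<Sum>u\<in>Delta n. gval 2 (u \<bullet> (fst c + fst c')) * L u)
      + r * (\<Sum>u\<in>Delta n. gval 1 (u \<bullet> (fst c - fst c')) * L u)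
      + t * (\<Sum>u\<in>Delta n. gval 2 (u \<bullet> (fst c - fst c')) * L u) \<le> 4 ^ n + 4 ^ n + 4 ^ n + 4 ^ n"
      by (intro add_mono le b inner_gval_L E Delta_closed D)
    then show ?thesis unfolding ex by simp
  qed
qed

text \<open>Expanding two of the three factors gives one triple sum for each ordered pair of
  columns, and \<open>triple_sum\<close> leaves only the odd pairs.\<close>

lemma sum_L_cube:
  "(\<Sum>u\<in>Delta n. L u ^ 3) \<le> 2 * 4 ^ n * real (card (odd_pairs n K))"
  "odd_pairs n K = {} \<Longrightarrow> (\<Sum>u\<in>Delta n. L u ^ 3) = 0"
proof -
  have "(\<Sum>u\<in>Delta n. L u ^ 3) = (\<Sum>u\<in>Delta n. \<Sum>c\<in>K. \<Sum>c'\<in>K. col_entry u c * col_entry u c' * L u)"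
    unfolding power3_eq_cube L_square by (simp add: sum_distrib_right)
  then have eq: "(\<Sum>u\<in>Delta n. L u ^ 3) = (\<Sum>c\<in>K. \<Sum>c'\<in>K. \<Sum>u\<in>Delta n. col_entry u c * col_entry u c' * L u)"
    unfolding swap_pairs .
  also have "\<dots> \<le> (\<Sum>c\<in>K. \<Sum>c'\<in>K. if (c, c') \<in> odd_pairs n K then 2 * 4 ^ n else 0)"
    by (intro sum_mono) (use triple_sum in auto)
  also have "\<dots> = (\<Sum>p\<in>(K \<times> K) \<inter> odd_pairs n K. 2 * 4 ^ n)"
    unfolding sum.cartesian_product by (simp add: split_def sum.inter_restrict[symmetric])
  also have "(K \<times> K) \<inter> odd_pairs n K = odd_pairs n K"
    by (auto simp: odd_pairs_def)
  finally show "(\<Sum>u\<in>Delta n. L u ^ 3) \<le> 2 * 4 ^ n * real (card (odd_pairs n K))" by (simp add: mult.commute)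
  show "(\<Sum>u\<in>Delta n. L u ^ 3) = 0" if "odd_pairs n K = {}"
    unfolding eq using triple_sum(1) that by simp
qed

text \<open>With \<open>K\<close> the complementary columns, these are the moments of the row sums
  of the remaining columns. In the mixed terms \<open>full_row_sum\<close> concentrates everything
  on the origin and the even vectors, where the moments of \<open>L\<close> are explicit; only the
  cube of \<open>L\<close> stays unevaluated.\<close>

lemma sum_complement:
  "(\<Sum>u\<in>Delta n. full_row_sum n u - L u) = 0"
  "(\<Sum>u\<in>Delta n. (full_row_sum n u - L u)\<^sup>2) = 4 ^ n * (4 ^ n - 2 ^ n - real (card K))"
  "(\<Sum>u\<in>Delta n. (full_row_sum n u - L u) ^ 3) =
    (\<Sum>u\<in>Delta n. full_row_sum n u ^ 3) - 3 * 4 ^ n * real (card K) * (4 ^ n - 2 * 2 ^ n)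
    + 3 * 4 ^ n * real (card (odd_pairs n K)) - (\<Sum>u\<in>Delta n. L u ^ 3)"
proof -
  let ?O = "full_row_sum n"
  have p: "(2::real) ^ n * 2 ^ n = 4 ^ n" by (simp add: power_mult_distrib[symmetric])
  have O1: "(\<Sum>u\<in>Delta n. ?O u) = 0"
    using sum_full_row_sum[of n "\<lambda>_. 1"] by (simp add: card_Even p)
  show "(\<Sum>u\<in>Delta n. ?O u - L u) = 0" by (simp add: sum_subtractf O1 sum_L)
  have OE: "(\<Sum>u\<in>Even n. ?O u) = 0"
    using sum_full_row_sum_Even[of n "\<lambda>_. 1"] by (simp add: card_Even p)
  have O2: "(\<Sum>u\<in>Delta n. ?O u * ?O u) = 4 ^ n * (4 ^ n - 2 ^ n)"
    unfolding sum_full_row_sum OE by (simp add: full_row_sum_0)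
  have OL: "(\<Sum>u\<in>Delta n. ?O u * L u) = 4 ^ n * real (card K)"
    unfolding sum_full_row_sum sum_L_Even L_0 by simp
  have "(\<Sum>u\<in>Delta n. (?O u - L u)\<^sup>2) = (\<Sum>u\<in>Delta n. ?O u * ?O u - 2 * (?O u * L u) + L u * L u)"
    by (intro sum.cong) (auto simp: power2_eq_square algebra_simps)
  also have "\<dots> = 4 ^ n * (4 ^ n - 2 ^ n) - 2 * (4 ^ n * real (card K)) + 4 ^ n * real (card K)"
    by (simp only: sum.distrib sum_subtractf sum_distrib_left[symmetric] O2 OL sum_L_square)
  finally show "(\<Sum>u\<in>Delta n. (?O u - L u)\<^sup>2) = 4 ^ n * (4 ^ n - 2 ^ n - real (card K))"
    by (simp add: algebra_simps)
  have OLE: "(\<Sum>u\<in>Even n. ?O u * L u) = 4 ^ n * real (card K)"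
    unfolding sum_full_row_sum_Even sum_L_Even L_0 by simp
  have OOL: "(\<Sum>u\<in>Delta n. ?O u * (?O u * L u)) = 4 ^ n * ((4 ^ n - 2 ^ n) * real (card K)) - 2 ^ n * (4 ^ n * real (card K))"
    unfolding sum_full_row_sum OLE by (simp add: full_row_sum_0 L_0)
  \<comment> \<open>The squares of \<open>card K\<close> from the origin and from the even vectors
    cancel, so exactly the count of odd pairs survives. Its factor 3 in the expansion of the cube
    gives the cost of an odd pair.\<close>
  have OLL: "(\<Sum>u\<in>Delta n. ?O u * (L u * L u)) = 4 ^ n * real (card (odd_pairs n K))"
  proof -
    have "(\<Sum>u\<in>Delta n. ?O u * (L u * L u)) =
        4 ^ n * (real (card K) * real (card K)) - (2 ^ n * 2 ^ n) * ((real (card K))\<^sup>2 - real (card (odd_pairs n K)))"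
      unfolding sum_full_row_sum sum_L_square_Even L_0 by simp
    also have "\<dots> = 4 ^ n * real (card (odd_pairs n K))"
      unfolding p by (simp add: power2_eq_square algebra_simps)
    finally show ?thesis .
  qed
  have "(\<Sum>u\<in>Delta n. (?O u - L u) ^ 3) =
      (\<Sum>u\<in>Delta n. ?O u ^ 3 - 3 * (?O u * (?O u * L u)) + 3 * (?O u * (L u * L u)) - L u ^ 3)"
    by (intro sum.cong) (auto simp: power3_eq_cube algebra_simps)
  also have "\<dots> = (\<Sum>u\<in>Delta n. ?O u ^ 3) - 3 * (4 ^ n * ((4 ^ n - 2 ^ n) * real (card K)) - 2 ^ n * (4 ^ n * real (card K)))
      + 3 * (4 ^ n * real (card (odd_pairs n K))) - (\<Sum>u\<in>Delta n. L u ^ 3)"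
    by (simp only: sum.distrib sum_subtractf sum_distrib_left[symmetric] OOL OLL)
  finally show "(\<Sum>u\<in>Delta n. (?O u - L u) ^ 3) =
    (\<Sum>u\<in>Delta n. ?O u ^ 3) - 3 * 4 ^ n * real (card K) * (4 ^ n - 2 * 2 ^ n)
    + 3 * 4 ^ n * real (card (odd_pairs n K)) - (\<Sum>u\<in>Delta n. L u ^ 3)"
    by (simp add: algebra_simps)
qed

end

text \<open>The part of the third entry that depends only on the number \<open>m\<close> of vectors
  with both columns missing: \<open>Suc (2 * m)\<close> counts the complementary columns, and 6 is
  the denominator of the third elementary symmetric function.\<close>

definition min_wordlength_3 :: "nat \<Rightarrow> nat \<Rightarrow> real" where
  "min_wordlength_3 p m = ((\<Sum>u\<in>Delta p. full_row_sum p u ^ 3)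
     - 3 * 4 ^ p * real (Suc (2 * m)) * (4 ^ p - 2 * 2 ^ p)) / (6 * 4 ^ p)"

section \<open>Designs with one column deleted from a pair\<close>

locale QC_design =
  fixes n :: nat and T :: "z4 vec set" and g :: "z4 vec"
  assumes T: "T \<subseteq> Omega n" and g: "g \<in> T"
begin

text \<open>The complement of the remaining columns inside the design of all of
  \<open>Omega\<close>.\<close>

definition K :: "nat \<Rightarrow> (z4 vec \<times> nat) set" where
  "K b = insert (g, b) ((Omega n - T) \<times> {1, 2})"

lemma finite_T: "finite T"
  using T finite_subset finite_Omega by blast

lemma column_set_K: "b \<in> {1, 2} \<Longrightarrow> column_set n (K b)"
  using T g by unfold_locales (auto simp: K_def)

lemma card_K: "card (K b) = Suc (2 * card (Omega n - T))"
  using g by (simp add: K_def card_cartesian_product)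

lemma card_columns: "b \<in> {1, 2} \<Longrightarrow> card (T \<times> {1, 2} - {(g, b)}) = 2 * card T - 1" for b :: nat
  using g finite_T by (subst card_Diff_subset) (auto simp: card_cartesian_product)

lemma card_T: "2 * real (card T) = 4 ^ n - 2 ^ n - 2 * real (card (Omega n - T))"
proof -
  have "card (Omega n - T) = card (Omega n) - card T"
    by (rule card_Diff_subset[OF finite_T T])
  moreover have "card T \<le> card (Omega n)" using T by (intro card_mono) auto
  moreover have "2 * real (card (Omega n)) = 4 ^ n - 2 ^ n"
    using sum_not_Even[of "\<lambda>_. 1" n]
    by (simp add: card_Diff_subset Even_subset card_Delta card_Even of_nat_diff power_mono)
  ultimately show ?thesis by simp
qed

lemma card_T_pos: "0 < card T"
  using finite_T g card_gt_0_iff by blast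

lemma sum_columns:
  assumes b: "b \<in> {1, 2}" and "d \<in> Delta n"
  shows "(\<Sum>c\<in>T \<times> {1, 2} - {(g, b)}. col_entry d c) = full_row_sum n d - row_sum (K b) d"
proof -
  have "Omega n \<times> {1, 2} = (T \<times> {1, 2} - {(g, b)}) \<union> K b" "(T \<times> {1, 2} - {(g, b)}) \<inter> K b = {}"
    using T g b by (auto simp: K_def)
  moreover have "finite (K b)" using column_set.finite_K[OF column_set_K[OF b]] .
  ultimately have "(\<Sum>c\<in>Omega n \<times> {1, 2}. col_entry d c) =
      (\<Sum>c\<in>T \<times> {1, 2} - {(g, b)}. col_entry d c) + (\<Sum>c\<in>K b. col_entry d c)"
    using finite_T by (simp add: sum.union_disjoint)
  then show ?thesis using sum_col_entry_Omega[OF assms(2)] by (simp add: row_sum_def)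
qed

definition D :: "nat \<Rightarrow> (z4 vec, z4 vec \<times> nat) design" where
  "D b = delete_factor (g, b) (even_design n T)"

lemma finite_factors: "finite (factors (D b))"
  using finite_T by (simp add: D_def delete_factor_def even_design_def)

text \<open>The column \<open>b0\<close> actually deleted does not occur on the right: by
  \<open>gen_poly_QC\<close> both possible deletions from the pair of \<open>g\<close> enter
  symmetrically.\<close>

lemma coeff_gen_poly_D:
  assumes "b0 \<in> {1, 2}"
  shows "wordlength (D b0) k = 1 / (2 * 4 ^ n) *
    (\<Sum>b\<in>{1, 2}. \<Sum>d\<in>Delta n. coeff (\<Prod>c\<in>T \<times> {1, 2} - {(g, b)}. [:1, col_entry d c:]) k)"
  unfolding coeff_gen_poly[OF finite_factors, symmetric]
  unfolding D_def gen_poly_QC[OF T g assms] coeff_smult coeff_sum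
  by (subst sum.swap) (rule refl)

text \<open>The first two moments in \<open>sum_complement\<close> fix these entries for every
  design, so lexicographic comparisons may start at index 0 instead of 3.\<close>

lemma wordlength_le_2:
  assumes "b0 \<in> {1, 2}"
  shows "wordlength (D b0) 0 = 1" "wordlength (D b0) 1 = 0" "wordlength (D b0) 2 = 0"
proof -
  have co: "coeff (\<Prod>c\<in>T \<times> {1, 2} - {(g, b)}. [:1, col_entry d c:]) 0 = 1"
    "coeff (\<Prod>c\<in>T \<times> {1, 2} - {(g, b)}. [:1, col_entry d c:]) 1 = full_row_sum n d - row_sum (K b) d"
    "coeff (\<Prod>c\<in>T \<times> {1, 2} - {(g, b)}. [:1, col_entry d c:]) 2 =
      ((full_row_sum n d - row_sum (K b) d)\<^sup>2 - real (2 * card T - 1)) / 2"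
    if "b \<in> {1, 2}" "d \<in> Delta n" for b d
    using coeff_prod_signs[of "T \<times> {1, 2} - {(g, b)}" "col_entry d"] sum_columns[OF that]
      card_columns[OF that(1)] finite_T by simp_all
  show "wordlength (D b0) 0 = 1"
  proof -
    have "(\<Sum>d\<in>Delta n. coeff (\<Prod>c\<in>T \<times> {1, 2} - {(g, b)}. [:1, col_entry d c:]) 0) = 4 ^ n"
      if "b \<in> {1, 2}" for b
      using co(1)[OF that] by (simp add: card_Delta)
    then show ?thesis unfolding coeff_gen_poly_D[OF assms] by simp
  qed
  have "(\<Sum>d\<in>Delta n. coeff (\<Prod>c\<in>T \<times> {1, 2} - {(g, b)}. [:1, col_entry d c:]) 1) = 0"
    if b: "b \<in> {1, 2}" for b
    using column_set.sum_complement(1)[OF column_set_K[OF b]] co(2)[OF b] by simp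
  then show "wordlength (D b0) 1 = 0"
    unfolding coeff_gen_poly_D[OF assms] by simp
  have q: "real (2 * card T - 1) = 4 ^ n - 2 ^ n - real (card (K b))" for b
    using card_T card_T_pos by (simp add: card_K of_nat_diff)
  have "(\<Sum>d\<in>Delta n. coeff (\<Prod>c\<in>T \<times> {1, 2} - {(g, b)}. [:1, col_entry d c:]) 2) = 0"
    if b: "b \<in> {1, 2}" for b
  proof -
    have "(\<Sum>d\<in>Delta n. coeff (\<Prod>c\<in>T \<times> {1, 2} - {(g, b)}. [:1, col_entry d c:]) 2) =
        ((\<Sum>d\<in>Delta n. (full_row_sum n d - row_sum (K b) d)\<^sup>2) - 4 ^ n * real (2 * card T - 1)) / 2"
    proof -
      have "(\<Sum>d\<in>Delta n. coeff (\<Prod>c\<in>T \<times> {1, 2} - {(g, b)}. [:1, col_entry d c:]) 2) =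
          (\<Sum>d\<in>Delta n. ((full_row_sum n d - row_sum (K b) d)\<^sup>2 - real (2 * card T - 1)) / 2)"
        by (intro sum.cong refl co(3)[OF b])
      then show ?thesis
        by (simp only: sum_subtractf sum_divide_distrib[symmetric] sum_constant card_Delta of_nat_power of_nat_numeral)
    qed
    then show ?thesis
      unfolding column_set.sum_complement(2)[OF column_set_K[OF b]] q[of b] by simp
  qed
  then show "wordlength (D b0) 2 = 0"
    unfolding coeff_gen_poly_D[OF assms] by simp
qed

text \<open>The linear term of the third elementary symmetric function drops out because the row
  sums add up to zero. What remains is the third moment, averaged over the two possible
  deletions.\<close>

lemma wordlength_3:
  assumes "b0 \<in> {1, 2}"
  shows "wordlength (D b0) 3 = min_wordlength_3 n (card (Omega n - T)) +
    1 / (12 * 4 ^ n) * (\<Sum>b\<in>{1, 2}.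
      3 * 4 ^ n * real (card (odd_pairs n (K b))) - (\<Sum>u\<in>Delta n. row_sum (K b) u ^ 3))"
proof -
  define c where "c = (\<Sum>u\<in>Delta n. full_row_sum n u ^ 3)
     - 3 * 4 ^ n * real (Suc (2 * card (Omega n - T))) * (4 ^ n - 2 * 2 ^ n)"
  define f where "f b = 3 * 4 ^ n * real (card (odd_pairs n (K b))) - (\<Sum>u\<in>Delta n. row_sum (K b) u ^ 3)" for b
  have "(\<Sum>d\<in>Delta n. coeff (\<Prod>c\<in>T \<times> {1, 2} - {(g, b)}. [:1, col_entry d c:]) 3) = (c + f b) / 6"
    if b: "b \<in> {1, 2}" for b
  proof -
    interpret column_set n "K b" by (rule column_set_K[OF b])
    have "coeff (\<Prod>c\<in>T \<times> {1, 2} - {(g, b)}. [:1, col_entry d c:]) 3 =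
        ((full_row_sum n d - row_sum (K b) d) ^ 3 - (3 * real (2 * card T - 1) - 2) * (full_row_sum n d - row_sum (K b) d)) / 6"
      if "d \<in> Delta n" for d
      using coeff_prod_signs(4)[of "T \<times> {1, 2} - {(g, b)}" "col_entry d"] sum_columns[OF b that]
        card_columns[OF b] finite_T by simp
    then have "(\<Sum>d\<in>Delta n. coeff (\<Prod>c\<in>T \<times> {1, 2} - {(g, b)}. [:1, col_entry d c:]) 3) =
        (\<Sum>d\<in>Delta n. ((full_row_sum n d - row_sum (K b) d) ^ 3 - (3 * real (2 * card T - 1) - 2) * (full_row_sum n d - row_sum (K b) d)) / 6)"
      by (rule sum.cong[OF refl])
    then have "(\<Sum>d\<in>Delta n. coeff (\<Prod>c\<in>T \<times> {1, 2} - {(g, b)}. [:1, col_entry d c:]) 3) =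
        ((\<Sum>d\<in>Delta n. (full_row_sum n d - row_sum (K b) d) ^ 3)
          - (3 * real (2 * card T - 1) - 2) * (\<Sum>d\<in>Delta n. full_row_sum n d - row_sum (K b) d)) / 6"
      by (simp only: sum_subtractf[of "\<lambda>d. (full_row_sum n d - row_sum (K b) d) ^ 3"]
          sum_divide_distrib[symmetric] sum_distrib_left[symmetric])
    then show ?thesis
      unfolding sum_complement card_K c_def f_def by simp
  qed
  then have "(\<Sum>b\<in>{1, 2}. \<Sum>d\<in>Delta n. coeff (\<Prod>c\<in>T \<times> {1, 2} - {(g, b)}. [:1, col_entry d c:]) 3) =
      (\<Sum>b\<in>{1, 2}. (c + f b) / 6)"
    by (rule sum.cong[OF refl])
  then have "wordlength (D b0) 3 = 1 / (2 * 4 ^ n) * ((c + f 1) / 6 + (c + f 2) / 6)"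
    unfolding coeff_gen_poly_D[OF assms] by simp
  also have "\<dots> = c / (6 * 4 ^ n) + 1 / (12 * 4 ^ n) * (f 1 + f 2)"
    by (simp add: field_simps)
  finally show ?thesis by (simp add: c_def f_def min_wordlength_3_def)
qed

text \<open>The vector \<open>g\<close> lies in \<open>T\<close> but has lost a column, so it counts
  among the complementary vectors.\<close>

definition is_even :: bool where
  "is_even \<longleftrightarrow> (\<forall>h\<in>insert g (Omega n - T). \<forall>h'\<in>insert g (Omega n - T). h + h' \<in> Even n)"

lemma wordlength_3_even:
  assumes "b0 \<in> {1, 2}" is_even
  shows "wordlength (D b0) 3 = min_wordlength_3 n (card (Omega n - T))"
proof -
  have e: "odd_pairs n (K b) = {}" for b
    using assms(2) unfolding is_even_def odd_pairs_def K_def by fastforce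
  have "(\<Sum>u\<in>Delta n. row_sum (K b) u ^ 3) = 0" if "b \<in> {1, 2}" for b
    using column_set.sum_L_cube(2)[OF column_set_K[OF that] e] .
  then show ?thesis unfolding wordlength_3[OF assms(1)] by (simp add: e)
qed

text \<open>Whichever column of \<open>g\<close> is deleted, some odd pair exists; each costs
  \<open>3 * 4 ^ n\<close>, while the third moment of the complement recovers at most
  \<open>2 * 4 ^ n\<close> per pair.\<close>

lemma wordlength_3_not_even:
  assumes "b0 \<in> {1, 2}" "\<not> is_even"
  shows "min_wordlength_3 n (card (Omega n - T)) < wordlength (D b0) 3"
proof -
  have pos: "0 < 3 * 4 ^ n * real (card (odd_pairs n (K b))) - (\<Sum>u\<in>Delta n. row_sum (K b) u ^ 3)"
    if b: "b \<in> {1, 2}" for b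
  proof -
    interpret column_set n "K b" by (rule column_set_K[OF b])
    obtain h h' where h: "h \<in> insert g (Omega n - T)" "h' \<in> insert g (Omega n - T)" "h + h' \<notin> Even n"
      using assms(2) by (auto simp: is_even_def)
    have ex: "\<exists>a. (x, a) \<in> K b" if "x \<in> insert g (Omega n - T)" for x
      using that unfolding K_def by auto
    obtain a a' where "(h, a) \<in> K b" "(h', a') \<in> K b" using ex h by blast
    then have "((h, a), (h', a')) \<in> odd_pairs n (K b)" using h by (simp add: odd_pairs_def)
    then have "0 < card (odd_pairs n (K b))" using card_gt_0_iff finite_odd_pairs by blast
    then have "2 * 4 ^ n * real (card (odd_pairs n (K b))) < 3 * 4 ^ n * real (card (odd_pairs n (K b)))"
      by simp
    then show ?thesis using sum_L_cube(1) by linarith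
  qed
  then have "0 < (\<Sum>b\<in>{1, 2}. 3 * 4 ^ n * real (card (odd_pairs n (K b))) - (\<Sum>u\<in>Delta n. row_sum (K b) u ^ 3))"
    by (intro sum_pos) auto
  then show ?thesis unfolding wordlength_3[OF assms(1)] less_add_same_cancel1
    by (intro mult_pos_pos) simp_all
qed

end

section \<open>Generating functions of even sets\<close>

text \<open>The logarithm is the inverse hyperbolic tangent of \<open>x\<close>. The factors
  \<open>1 + x\<close> and \<open>1 - x\<close> are \<open>sqrt (1 - x\<^sup>2)\<close> times its
  exponential and the reciprocal of that, so a product of them sees only the number of signs and
  their sum.\<close>

lemma prod_signs_exp:
  fixes x :: real
  assumes x: "\<bar>x\<bar> < 1" and A: "finite A" "\<And>c. c \<in> A \<Longrightarrow> e c = 1 \<or> e c = - 1"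
  shows "(\<Prod>c\<in>A. 1 + x * e c) = sqrt (1 - x\<^sup>2) ^ card A * exp (ln ((1 + x) / sqrt (1 - x\<^sup>2)) * (\<Sum>c\<in>A. e c))"
proof -
  define r where "r = sqrt (1 - x\<^sup>2)"
  define \<theta> where "\<theta> = ln ((1 + x) / r)"
  have sq: "0 < 1 - x\<^sup>2" using x by (simp add: abs_square_less_1)
  then have r: "0 < r" "r * r = (1 + x) * (1 - x)"
    by (simp_all add: r_def algebra_simps power2_eq_square)
  have x1: "0 < 1 + x" "0 < 1 - x" using x by auto
  have "exp \<theta> = (1 + x) / r" using r x1 by (simp add: \<theta>_def)
  moreover have "exp (- \<theta>) = (1 - x) / r"
  proof -
    have "exp (- \<theta>) = r / (1 + x)" using calculation by (simp add: exp_minus)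
    also have "\<dots> = (1 - x) / r" using r x1 by (simp add: frac_eq_eq mult.commute)
    finally show ?thesis .
  qed
  ultimately have 1: "1 + x * s = r * exp (\<theta> * s)" if "s = 1 \<or> s = - 1" for s
    using that r by auto
  have "(\<Prod>c\<in>A. 1 + x * e c) = (\<Prod>c\<in>A. r * exp (\<theta> * e c))"
    using A 1 by (intro prod.cong) auto
  also have "\<dots> = r ^ card A * exp (\<theta> * (\<Sum>c\<in>A. e c))"
    using A by (simp add: prod.distrib exp_sum sum_distrib_left)
  finally show ?thesis unfolding r_def \<theta>_def .
qed

section \<open>Coordinates adapted to the vector \<open>g\<close>\<close>

definition skip :: "nat \<Rightarrow> nat \<Rightarrow> nat" where
  "skip i k = (if k < i then k else Suc k)"

text \<open>\<open>skip i\<close> enumerates the indices other than \<open>i\<close> in increasing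
  order, so that they can be numbered from 0.\<close>

lemma sum_skip:
  assumes "i < n"
  shows "(\<Sum>k<n. F k) = F i + (\<Sum>k<n - 1. F (skip i k))"
proof -
  have inj: "inj_on (skip i) {..<n - 1}" by (auto simp: inj_on_def skip_def split: if_splits)
  have "k \<in> skip i ` {..<n - 1}" if "k < n" "k \<noteq> i" for k
    using that assms
    by (intro image_eqI[of _ _ "if k < i then k else k - 1"]) (auto simp: skip_def)
  then have eq: "{..<n} = insert i (skip i ` {..<n - 1})"
    using assms by (auto simp: skip_def)
  have "i \<notin> skip i ` {..<n - 1}" by (auto simp: skip_def split: if_splits)
  then show ?thesis unfolding eq by (simp add: sum.reindex[OF inj] del: One_nat_def)
qed

lemma skip_less: "i < n \<Longrightarrow> k < n - 1 \<Longrightarrow> skip i k < n"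
  by (auto simp: skip_def)

lemma skip_cases:
  assumes "i < n" "k < n"
  obtains "k = i" | k' where "k' < n - 1" "k = skip i k'"
proof (cases "k = i")
  case False
  then consider "k < i" | "k > i" by linarith
  then show ?thesis
  proof cases
    case 1
    then show ?thesis using assms that(2)[of k] by (simp add: skip_def)
  next
    case 2
    then show ?thesis using assms that(2)[of "k - 1"] by (simp add: skip_def)
  qed
qed (use that in auto)

definition delete_coord :: "nat \<Rightarrow> nat \<Rightarrow> z4 vec \<Rightarrow> z4 vec" where
  "delete_coord n i u = vec (n - 1) (\<lambda>k. u $ skip i k)"

lemma delete_coord_Delta [simp]: "delete_coord n i u \<in> Delta (n - 1)"
  by (simp add: delete_coord_def Delta_def)

lemma dot_skip:
  fixes u h :: "z4 vec"
  assumes "i < n" "u \<in> Delta n" "h \<in> Delta n"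
  shows "u \<bullet> h = u $ i * h $ i + (\<Sum>k<n - 1. delete_coord n i u $ k * h $ skip i k)"
proof -
  have "u \<bullet> h = (\<Sum>k<n. u $ k * h $ k)"
    using assms by (simp add: scalar_prod_def atLeast0LessThan)
  then show ?thesis unfolding sum_skip[OF assms(1)] by (simp add: delete_coord_def)
qed

text \<open>As \<open>g $ i = 1\<close>, the entry \<open>u $ i\<close> can be recovered from
  \<open>u \<bullet> g\<close> and the other entries; surjectivity follows by counting.\<close>

lemma bij_coords:
  assumes "i < n" "g \<in> Delta n" "g $ i = 1"
  shows "bij_betw (\<lambda>u. (u \<bullet> g, delete_coord n i u)) (Delta n) (UNIV \<times> Delta (n - 1))"
proof -
  have inj: "inj_on (\<lambda>u. (u \<bullet> g, delete_coord n i u)) (Delta n)"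
  proof (rule inj_onI)
    fix u w assume uw: "u \<in> Delta n" "w \<in> Delta n"
      and "(u \<bullet> g, delete_coord n i u) = (w \<bullet> g, delete_coord n i w)"
    then have eq: "u \<bullet> g = w \<bullet> g" "delete_coord n i u = delete_coord n i w" by auto
    have i: "u $ i = w $ i"
      using eq dot_skip[OF assms(1) uw(1) assms(2)] dot_skip[OF assms(1) uw(2) assms(2)] assms(3) by simp
    have k: "u $ skip i k = w $ skip i k" if "k < n - 1" for k
      using arg_cong[OF eq(2), of "\<lambda>v. v $ k"] that by (simp add: delete_coord_def)
    show "u = w"
    proof (rule eq_vecI)
      fix k assume "k < dim_vec w"
      then have "k < n" using uw by simp
      then show "u $ k = w $ k" using i k by (cases rule: skip_cases[OF assms(1)]) auto
    qed (use uw in simp)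
  qed
  have "card ((\<lambda>u. (u \<bullet> g, delete_coord n i u)) ` Delta n) = card (UNIV \<times> Delta (n - 1) :: (z4 \<times> z4 vec) set)"
    using assms(1) by (simp add: card_image[OF inj] card_Delta card_cartesian_product power_eq_if)
  then have "(\<lambda>u. (u \<bullet> g, delete_coord n i u)) ` Delta n = UNIV \<times> Delta (n - 1)"
    by (intro card_subset_eq) (auto simp del: One_nat_def)
  then show ?thesis using inj by (simp add: bij_betw_def)
qed

definition bin_form :: "nat mat \<Rightarrow> nat \<Rightarrow> z4 vec \<Rightarrow> z4" where
  "bin_form B j w = (\<Sum>k<dim_row B. w $ k * of_nat (B $$ (k, j)))"

text \<open>By \<open>entry_regular\<close>, for a binary matrix this is the row sum of the regular
  design at the reduction of \<open>w\<close> modulo 2. Working with \<open>z4\<close> vectors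
  avoids a change of index set in the comparison with the quaternary design.\<close>

definition char_sum :: "nat mat \<Rightarrow> z4 vec \<Rightarrow> real" where
  "char_sum B w = (\<Sum>j<dim_col B. chi (bin_form B j w))"

lemma chi_bin_form_Even:
  assumes "w \<in> Even (dim_row B)"
  shows "chi (bin_form B j w) = 1"
proof -
  have "chi (w $ k * of_nat (B $$ (k, j))) = 1" if "k < dim_row B" for k
    using assms that by (simp add: Even_def chi_def z4_even_mult)
  then show ?thesis unfolding bin_form_def by (simp add: chi_sum)
qed

lemma char_sum_Even: "w \<in> Even (dim_row B) \<Longrightarrow> char_sum B w = dim_col B"
  by (simp add: char_sum_def chi_bin_form_Even)

text \<open>The dot product with the deleted vector and the remaining coordinates determine \<open>u\<close>; in these
  terms, \<open>even_const\<close> collects the contributions that do not depend on the binary matrix.\<close>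

definition coord_row_sum :: "nat \<Rightarrow> z4 \<Rightarrow> z4 vec \<Rightarrow> real" where
  "coord_row_sum n a w = (if a = 0 \<and> w = 0\<^sub>v (n - 1) then 4 ^ n else 0)
     - (if z4_even a \<and> w \<in> Even (n - 1) then 2 ^ n else 0)"

definition even_const :: "nat \<Rightarrow> nat \<Rightarrow> real \<Rightarrow> z4 \<Rightarrow> z4 vec \<Rightarrow> real" where
  "even_const n m \<theta> a w =
     (if \<not> z4_even a then \<Sum>b\<in>{1, 2}. exp (- \<theta> * gval b a)
      else if w \<in> Even (n - 1) then
        2 * exp (\<theta> * (coord_row_sum n a w - gval 1 a * (2 * real m + 1)))
        - 2 * exp (- \<theta> * gval 1 a * (2 * real m + 1))
      else 0)"

locale QC_even = QC_design +
  fixes i :: nat and B :: "nat mat" and hs :: "nat \<Rightarrow> z4 vec"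
  assumes hs: "bij_betw hs {..<dim_col B} (Omega n - T)"
    and i: "i < n" "g $ i = 1" and dim_B: "dim_row B = n - 1"
    and hs_i: "\<And>j. j < dim_col B \<Longrightarrow> hs j $ i = 1"
    and hs_skip: "\<And>j k. j < dim_col B \<Longrightarrow> k < n - 1 \<Longrightarrow>
      hs j $ skip i k = g $ skip i k + 2 * of_nat (B $$ (k, j))"
begin

lemma g_Delta: "g \<in> Delta n" using T g OmegaD by blast

lemma hs_Delta: "j < dim_col B \<Longrightarrow> hs j \<in> Delta n"
  using bij_betwE[OF hs] OmegaD by blast

lemma dot_hs:
  assumes "u \<in> Delta n" "j < dim_col B"
  shows "u \<bullet> hs j = u \<bullet> g + 2 * bin_form B j (delete_coord n i u)"
  using i(2) hs_i[OF assms(2)] hs_skip[OF assms(2)]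
  unfolding dot_skip[OF i(1) assms(1) g_Delta] dot_skip[OF i(1) assms(1) hs_Delta[OF assms(2)]] bin_form_def dim_B
  by (simp add: algebra_simps sum.distrib sum_distrib_left)

lemma row_sum_K:
  assumes "u \<in> Delta n" "b \<in> {1, 2}"
  shows "row_sum (K b) u = (gval 1 (u \<bullet> g) + gval 2 (u \<bullet> g)) * char_sum B (delete_coord n i u) + gval b (u \<bullet> g)"
proof -
  have "row_sum (K b) u = col_entry u (g, b) + (\<Sum>h\<in>Omega n - T. col_entry u (h, 1) + col_entry u (h, 2))"
    unfolding row_sum_def K_def sum_pairs[symmetric] using g by (subst sum.insert) auto
  also have "(\<Sum>h\<in>Omega n - T. col_entry u (h, 1) + col_entry u (h, 2)) =
      (\<Sum>j<dim_col B. col_entry u (hs j, 1) + col_entry u (hs j, 2))"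
    by (rule sum.reindex_bij_betw[OF hs, symmetric])
  also have "\<dots> = (\<Sum>j<dim_col B. (gval 1 (u \<bullet> g) + gval 2 (u \<bullet> g)) * chi (bin_form B j (delete_coord n i u)))"
    by (intro sum.cong refl) (simp add: col_entry_def dot_hs[OF assms(1)] gval_add_double algebra_simps)
  finally show ?thesis by (simp add: col_entry_def char_sum_def sum_distrib_left)
qed

lemma full_row_sum_coords:
  assumes u: "u \<in> Delta n"
  shows "full_row_sum n u = coord_row_sum n (u \<bullet> g) (delete_coord n i u)"
proof -
  have d0: "delete_coord n i (0\<^sub>v n) = 0\<^sub>v (n - 1)"
    by (rule eq_vecI) (auto simp: delete_coord_def skip_less[OF i(1)])
  have "u = 0\<^sub>v n \<longleftrightarrow> u \<bullet> g = 0 \<and> delete_coord n i u = 0\<^sub>v (n - 1)"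
    using inj_onD[OF bij_betw_imp_inj_on[OF bij_coords[OF i(1) g_Delta i(2)]], of u "0\<^sub>v n"] u g_Delta d0 by auto
  moreover have "u \<in> Even n \<longleftrightarrow> z4_even (u \<bullet> g) \<and> delete_coord n i u \<in> Even (n - 1)"
  proof
    assume "u \<in> Even n"
    then show "z4_even (u \<bullet> g) \<and> delete_coord n i u \<in> Even (n - 1)"
      using Even_dot_even[OF _ g_Delta] skip_less[OF i(1)] by (auto simp: Even_def delete_coord_def Delta_def)
  next
    assume *: "z4_even (u \<bullet> g) \<and> delete_coord n i u \<in> Even (n - 1)"
    have "z4_even (\<Sum>k<n - 1. delete_coord n i u $ k * g $ skip i k)"
      using * by (intro z4_even_sum z4_even_mult) (auto simp: Even_def)
    then have "z4_even (u $ i)"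
      using * unfolding dot_skip[OF i(1) u g_Delta] i(2) by (simp add: z4_even_add)
    moreover have "z4_even (u $ skip i k)" if "k < n - 1" for k
      using * that by (auto simp: Even_def delete_coord_def)
    ultimately have "z4_even (u $ k)" if "k < n" for k
      using that by (cases rule: skip_cases[OF i(1)]) auto
    then show "u \<in> Even n" using u by (simp add: Even_def)
  qed
  ultimately show ?thesis by (simp add: full_row_sum_def coord_row_sum_def)
qed

text \<open>If \<open>u \<bullet> g\<close> is odd, the two columns of \<open>g\<close> cancel and
  \<open>B\<close> has no influence. If it is even, they agree and the complementary row sum is
  \<open>2 * char_sum B w + 1\<close> up to sign. At even \<open>w\<close> all characters are 1, so
  replacing the true term by this generic one changes the sum by an amount free of \<open>B\<close>
  apart from its number of columns.\<close>

lemma sum_exp: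
  "(\<Sum>u\<in>Delta n. \<Sum>b\<in>{1, 2}. exp (\<theta> * (full_row_sum n u - row_sum (K b) u))) =
   (\<Sum>a\<in>UNIV. \<Sum>w\<in>Delta (n - 1). even_const n (dim_col B) \<theta> a w)
   + 2 * (\<Sum>w\<in>Delta (n - 1). exp (\<theta> * (2 * char_sum B w + 1)) + exp (- \<theta> * (2 * char_sum B w + 1)))"
proof -
  define F where "F a w = (\<Sum>b\<in>{1, 2}. exp (\<theta> * (coord_row_sum n a w
    - ((gval 1 a + gval 2 a) * char_sum B w + gval b a))))" for a w
  define G where "G a w = (if z4_even a then 2 * exp (- \<theta> * gval 1 a * (2 * char_sum B w + 1)) else 0)" for a w
  have F: "F a w = even_const n (dim_col B) \<theta> a w + G a w" if "w \<in> Delta (n - 1)" for a w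
  proof (cases "z4_even a")
    case True
    then have a: "gval 2 a = gval 1 a" using gval_even by blast
    show ?thesis
    proof (cases "w \<in> Even (n - 1)")
      case w: True
      then have "char_sum B w = dim_col B" by (simp add: char_sum_Even dim_B)
      then show ?thesis using True w
        unfolding F_def G_def even_const_def by (simp add: a algebra_simps)
    next
      case w: False
      then have "coord_row_sum n a w = 0"
        by (auto simp: coord_row_sum_def)
      then show ?thesis using True w
        unfolding F_def G_def even_const_def by (simp add: a algebra_simps)
    qed
  next
    case False
    then have "coord_row_sum n a w = 0" by (auto simp: coord_row_sum_def)
    then show ?thesis
      using False gval_odd_sum[OF False] unfolding F_def G_def even_const_def by simp
  qed
  have "(\<Sum>u\<in>Delta n. \<Sum>b\<in>{1, 2}. exp (\<theta> * (full_row_sum n u - row_sum (K b) u))) =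
      (\<Sum>u\<in>Delta n. (\<lambda>(a, w). F a w) (u \<bullet> g, delete_coord n i u))"
    unfolding F_def prod.case by (intro sum.cong refl) (simp only: row_sum_K full_row_sum_coords)
  also have "\<dots> = (\<Sum>(a, w)\<in>UNIV \<times> Delta (n - 1). F a w)"
    by (rule sum.reindex_bij_betw[OF bij_coords[OF i(1) g_Delta i(2)]])
  also have "\<dots> = (\<Sum>a\<in>UNIV. \<Sum>w\<in>Delta (n - 1). F a w)"
    by (rule sum.cartesian_product[symmetric])
  also have "\<dots> = (\<Sum>a\<in>UNIV. \<Sum>w\<in>Delta (n - 1). even_const n (dim_col B) \<theta> a w)
      + (\<Sum>a\<in>UNIV. \<Sum>w\<in>Delta (n - 1). G a w)"
    by (simp add: F sum.distrib)
  also have "(\<Sum>a\<in>UNIV. \<Sum>w\<in>Delta (n - 1). G a w) = (\<Sum>w\<in>Delta (n - 1). \<Sum>a\<in>UNIV. G a w)"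
    by (rule sum.swap)
  also have "\<dots> = (\<Sum>w\<in>Delta (n - 1). 2 * (exp (\<theta> * (2 * char_sum B w + 1)) + exp (- \<theta> * (2 * char_sum B w + 1))))"
  proof (rule sum.cong[OF refl])
    fix w
    \<comment> \<open>Only 0 and 2 contribute, with opposite signs of \<open>gval 1\<close>; this is
      the origin of the two exponentials.\<close>
    have U: "(UNIV :: z4 set) = {0, 1, 2, 3}" using z4_exhaust by auto
    show "(\<Sum>a\<in>UNIV. G a w) = 2 * (exp (\<theta> * (2 * char_sum B w + 1)) + exp (- \<theta> * (2 * char_sum B w + 1)))"
      unfolding U by (simp add: G_def z4_even_def)
  qed
  finally show ?thesis by (simp only: sum_distrib_left)
qed

lemma poly_gen_poly:
  assumes x: "\<bar>x\<bar> < 1" and b0: "b0 \<in> {1, 2}"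
  defines "r \<equiv> sqrt (1 - x\<^sup>2)" and "\<theta> \<equiv> ln ((1 + x) / sqrt (1 - x\<^sup>2))"
  shows "poly (gen_poly (D b0)) x = r ^ (2 * card T - 1) / (2 * 4 ^ n) *
   ((\<Sum>a\<in>UNIV. \<Sum>w\<in>Delta (n - 1). even_const n (dim_col B) \<theta> a w)
   + 2 * (\<Sum>w\<in>Delta (n - 1). exp (\<theta> * (2 * char_sum B w + 1)) + exp (- \<theta> * (2 * char_sum B w + 1))))"
proof -
  have "poly (\<Prod>c\<in>T \<times> {1, 2} - {(g, b)}. [:1, col_entry u c:]) x =
      r ^ (2 * card T - 1) * exp (\<theta> * (full_row_sum n u - row_sum (K b) u))"
    if "u \<in> Delta n" "b \<in> {1, 2}" for u b
    using prod_signs_exp[OF x, of "T \<times> {1, 2} - {(g, b)}" "col_entry u"] finite_T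
      sum_columns[OF that(2,1)] card_columns[OF that(2)]
    by (simp add: poly_prod col_entry_cases r_def \<theta>_def)
  then have "poly (gen_poly (D b0)) x = 1 / (2 * 4 ^ n) * (\<Sum>u\<in>Delta n. \<Sum>b\<in>{1, 2}.
      r ^ (2 * card T - 1) * exp (\<theta> * (full_row_sum n u - row_sum (K b) u)))"
    unfolding D_def gen_poly_QC[OF T g b0] by (simp add: poly_sum)
  then show ?thesis
    unfolding sum_distrib_left[symmetric] sum_exp by simp
qed

end

section \<open>Regular designs\<close>

definition high_bit :: "z4 \<Rightarrow> nat" where
  "high_bit a = (if a = 0 \<or> a = 1 then 0 else 1)"

lemma parity_high_bit_inj: "parity a = parity b \<Longrightarrow> high_bit a = high_bit b \<Longrightarrow> a = b"
  by (cases a rule: z4_exhaust; cases b rule: z4_exhaust)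
    (simp_all add: parity_def high_bit_def z4_even_def)

definition bit_vecs :: "nat \<Rightarrow> nat vec set" where
  "bit_vecs p = {x \<in> carrier_vec p. \<forall>i<p. x $ i \<in> {0, 1}}"

lemma card_bit_vecs: "card (bit_vecs p) = 2 ^ p"
  using card_vecs[of p "{0, 1 :: nat}"] by (simp add: bit_vecs_def numeral_2_eq_2)

lemma finite_bit_vecs [simp]: "finite (bit_vecs p)"
  unfolding bit_vecs_def by (rule finite_vecs) simp

lemma map_vec_bit_vecs: "(\<And>a. f a \<in> {0, 1}) \<Longrightarrow> w \<in> Delta p \<Longrightarrow> map_vec f w \<in> bit_vecs p"
  by (simp add: bit_vecs_def Delta_def del: insert_iff)

text \<open>The high bits parametrize the fibre over each binary vector, which has
  \<open>2 ^ p\<close> elements. Sums over the runs of a regular design can thus be taken over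
  \<open>Delta p\<close>.\<close>

lemma sum_map_parity:
  fixes F :: "nat vec \<Rightarrow> real"
  shows "(\<Sum>w\<in>Delta p. F (map_vec parity w)) = 2 ^ p * (\<Sum>x\<in>bit_vecs p. F x)"
proof -
  let ?f = "\<lambda>w. (map_vec parity w, map_vec high_bit w)"
  have inj: "inj_on ?f (Delta p)"
  proof (rule inj_onI)
    fix u w assume uw: "u \<in> Delta p" "w \<in> Delta p" "?f u = ?f w"
    show "u = w"
    proof (rule eq_vecI)
      fix i assume i: "i < dim_vec w"
      have d: "dim_vec u = dim_vec w" using uw by simp
      have "map_vec parity u $ i = map_vec parity w $ i" "map_vec high_bit u $ i = map_vec high_bit w $ i"
        using uw(3) by simp_all
      then show "u $ i = w $ i" using i d parity_high_bit_inj by simp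
    qed (use uw in simp)
  qed
  have sub: "?f ` Delta p \<subseteq> bit_vecs p \<times> bit_vecs p"
    by (auto intro!: map_vec_bit_vecs simp: parity_def high_bit_def)
  have "card (?f ` Delta p) = card (bit_vecs p \<times> bit_vecs p)"
    by (simp add: card_image[OF inj] card_Delta card_bit_vecs card_cartesian_product power_mult_distrib[symmetric])
  then have "?f ` Delta p = bit_vecs p \<times> bit_vecs p"
    using sub by (intro card_subset_eq) auto
  then have bij: "bij_betw ?f (Delta p) (bit_vecs p \<times> bit_vecs p)"
    using inj by (simp add: bij_betw_def)
  have "(\<Sum>w\<in>Delta p. F (map_vec parity w)) = (\<Sum>w\<in>Delta p. (\<lambda>(x, y). F x) (?f w))"
    by simp
  also have "\<dots> = (\<Sum>(x, y)\<in>bit_vecs p \<times> bit_vecs p. F x)"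
    by (rule sum.reindex_bij_betw[OF bij])
  also have "\<dots> = (\<Sum>x\<in>bit_vecs p. \<Sum>y\<in>bit_vecs p. F x)"
    by (rule sum.cartesian_product[symmetric])
  finally show ?thesis by (simp add: card_bit_vecs sum_distrib_left)
qed

locale binary_mat =
  fixes p m :: nat and B :: "nat mat"
  assumes B: "B \<in> carrier_mat p m" and entries: "\<And>k j. k < p \<Longrightarrow> j < m \<Longrightarrow> B $$ (k, j) \<in> {0, 1}"
begin

lemma dims [simp]: "dim_row B = p" "dim_col B = m" using B by auto

abbreviation "\<chi> w j \<equiv> chi (bin_form B j w)"

lemma chi_prod: "\<chi> w j = (\<Prod>k<p. chi (w $ k * of_nat (B $$ (k, j))))"
  unfolding bin_form_def by (simp add: chi_sum)

lemma chi_add_vec: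
  assumes "u \<in> Delta p" "w \<in> Delta p"
  shows "\<chi> (u + w) j = \<chi> u j * \<chi> w j"
  unfolding chi_prod prod.distrib[symmetric]
  using assms by (intro prod.cong refl) (simp add: chi_add[symmetric] distrib_right Delta_def)

lemma entry_regular:
  assumes "w \<in> Delta p" "j < m"
  shows "entry (regular_design B) (map_vec parity w) j = \<chi> w j"
proof -
  have "\<chi> w j = (\<Prod>k<p. (- 1) ^ (parity (w $ k) * B $$ (k, j)))"
    unfolding chi_prod using entries assms(2) by (intro prod.cong refl chi_mult_of_nat) auto
  also have "\<dots> = (- 1) ^ (\<Sum>k<p. parity (w $ k) * B $$ (k, j))"
    by (rule power_sum[symmetric])
  also have "(\<Sum>k<p. parity (w $ k) * B $$ (k, j)) = map_vec parity w \<bullet> col B j"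
    using assms by (simp add: scalar_prod_def atLeast0LessThan Delta_def)
  finally show ?thesis by (simp add: regular_design_def)
qed

text \<open>The mean of a character over a group is 0 or 1 and so equals its own square. Hence a
  single sum over runs suffices here, unlike the double sum in \<open>gen_poly\<close>.\<close>

lemma wordlength_regular:
  "wordlength (regular_design B) k =
     1 / 4 ^ p * (\<Sum>w\<in>Delta p. \<Sum>H | H \<subseteq> {..<m} \<and> card H = k. \<Prod>j\<in>H. \<chi> w j)"
proof -
  have runs: "runs (regular_design B) = bit_vecs p" "factors (regular_design B) = {..<m}"
    by (simp_all add: regular_design_def bit_vecs_def)
  have "(rho (regular_design B) H)\<^sup>2 = 1 / 4 ^ p * (\<Sum>w\<in>Delta p. \<Prod>j\<in>H. \<chi> w j)"
    if H: "H \<subseteq> {..<m}" for H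
  proof -
    define S where "S = (\<Sum>w\<in>Delta p. \<Prod>j\<in>H. \<chi> w j)"
    define X where "X = (\<Sum>x\<in>bit_vecs p. \<Prod>j\<in>H. entry (regular_design B) x j)"
    have "S = (\<Sum>w\<in>Delta p. \<Prod>j\<in>H. entry (regular_design B) (map_vec parity w) j)"
      unfolding S_def using H by (intro sum.cong prod.cong refl) (auto simp: entry_regular subset_iff)
    then have SX: "S = 2 ^ p * X"
      using sum_map_parity[of "\<lambda>x. \<Prod>j\<in>H. entry (regular_design B) x j" p] unfolding X_def by simp
    \<comment> \<open>\<open>S\<close> is the sum of a character over a group, hence invariant under translations.\<close>
    have inv: "(\<Prod>j\<in>H. \<chi> u j) * S = S" if "u \<in> Delta p" for u
      unfolding S_def sum_distrib_left
      using sum_shift[OF that, of "\<lambda>w. \<Prod>j\<in>H. \<chi> w j"] that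
      by (simp add: chi_add_vec prod.distrib mult.commute)
    have "S * S = (\<Sum>u\<in>Delta p. \<Prod>j\<in>H. \<chi> u j) * S" by (simp add: S_def)
    also have "\<dots> = (\<Sum>u\<in>Delta p. (\<Prod>j\<in>H. \<chi> u j) * S)" by (rule sum_distrib_right)
    also have "\<dots> = (\<Sum>u\<in>Delta p. S)" by (rule sum.cong[OF refl inv])
    finally have "S * S = (\<Sum>u\<in>Delta p. S)" .
    then have "S * S = 4 ^ p * S" by (simp add: card_Delta)
    then have "(2 ^ p * X) * (2 ^ p * X) = 4 ^ p * (2 ^ p * X)" unfolding SX .
    have p4: "(4 :: real) ^ p = 2 ^ p * 2 ^ p" by (simp add: power_mult_distrib[symmetric])
    from \<open>(2 ^ p * X) * (2 ^ p * X) = 4 ^ p * (2 ^ p * X)\<close>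
    have XX: "X * X = 2 ^ p * X" unfolding p4 by simp
    have "(rho (regular_design B) H)\<^sup>2 = X * X / (2 ^ p * 2 ^ p)"
      by (simp add: rho_def runs card_bit_vecs X_def power2_eq_square)
    also have "\<dots> = S / 4 ^ p"
      unfolding XX SX[symmetric] p4 ..
    finally show ?thesis by (simp add: S_def)
  qed
  then have "wordlength (regular_design B) k =
      (\<Sum>H | H \<subseteq> {..<m} \<and> card H = k. 1 / 4 ^ p * (\<Sum>w\<in>Delta p. \<Prod>j\<in>H. \<chi> w j))"
    unfolding wordlength_def runs by (intro sum.cong refl) auto
  then show ?thesis
    unfolding sum_distrib_left[symmetric] by (subst sum.swap) simp
qed

text \<open>The homogeneous form in two variables lets \<open>2 * x\<close> and
  \<open>1 + x\<^sup>2\<close> be inserted without division.\<close>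

lemma wordlength_enumerator:
  "(\<Sum>k\<le>m. wordlength (regular_design B) k * z ^ k * y ^ (m - k)) =
    1 / 4 ^ p * (\<Sum>w\<in>Delta p. \<Prod>j<m. z * \<chi> w j + y)"
proof -
  have "(\<Sum>k\<le>m. wordlength (regular_design B) k * z ^ k * y ^ (m - k)) =
      1 / 4 ^ p * (\<Sum>k\<le>m. \<Sum>w\<in>Delta p. \<Sum>H | H \<subseteq> {..<m} \<and> card H = k. (\<Prod>j\<in>H. \<chi> w j) * (z ^ k * y ^ (m - k)))"
    unfolding wordlength_regular by (simp add: sum_distrib_left sum_distrib_right mult.assoc)
  also have "(\<Sum>k\<le>m. \<Sum>w\<in>Delta p. \<Sum>H | H \<subseteq> {..<m} \<and> card H = k. (\<Prod>j\<in>H. \<chi> w j) * (z ^ k * y ^ (m - k))) =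
      (\<Sum>w\<in>Delta p. \<Sum>k\<le>m. \<Sum>H | H \<subseteq> {..<m} \<and> card H = k. (\<Prod>j\<in>H. \<chi> w j) * (z ^ k * y ^ (m - k)))"
    by (rule sum.swap)
  also have "\<dots> = (\<Sum>w\<in>Delta p. \<Prod>j<m. z * \<chi> w j + y)"
  proof (rule sum.cong[OF refl])
    fix w
    have "(\<Prod>j<m. z * \<chi> w j + y) = (\<Sum>H\<in>Pow {..<m}. (\<Prod>j\<in>H. z * \<chi> w j) * (\<Prod>j\<in>{..<m} - H. y))"
      by (rule prod_add) simp
    also have "\<dots> = (\<Sum>H\<in>Pow {..<m}. (\<Prod>j\<in>H. \<chi> w j) * (z ^ card H * y ^ (m - card H)))"
      by (intro sum.cong refl)
        (auto simp: prod.distrib card_Diff_subset finite_subset[OF _ finite_lessThan])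
    also have "\<dots> = (\<Sum>k\<le>m. \<Sum>H | H \<in> Pow {..<m} \<and> card H = k. (\<Prod>j\<in>H. \<chi> w j) * (z ^ card H * y ^ (m - card H)))"
      by (rule sum.group[symmetric]) (auto dest: card_mono[rotated])
    also have "\<dots> = (\<Sum>k\<le>m. \<Sum>H | H \<subseteq> {..<m} \<and> card H = k. (\<Prod>j\<in>H. \<chi> w j) * (z ^ k * y ^ (m - k)))"
      by (intro sum.cong refl) auto
    finally show "(\<Sum>k\<le>m. \<Sum>H | H \<subseteq> {..<m} \<and> card H = k. (\<Prod>j\<in>H. \<chi> w j) * (z ^ k * y ^ (m - k))) =
        (\<Prod>j<m. z * \<chi> w j + y)" ..
  qed
  finally show ?thesis .
qed

text \<open>The wordlength enumerator at \<open>2x / (1 + x\<^sup>2)\<close>, cleared of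
  denominators. The extra factor \<open>1 + x\<close> corresponds to the single deleted column of
  \<open>g\<close> and also produces the floor in the binomial coefficients.\<close>

definition P :: "real poly" where
  "P = [:1, 1:] * (\<Sum>k\<le>m. smult (wordlength (regular_design B) k) ([:0, 2:] ^ k * [:1, 0, 1:] ^ (m - k)))"

text \<open>Twice the even part of \<open>P\<close>; the reflection supplies the second exponential
  of \<open>sum_exp\<close>.\<close>

definition Q :: "real poly" where
  "Q = P + P \<circ>\<^sub>p [:0, - 1:]"

lemma poly_P: "poly P x = (1 + x) / 4 ^ p * (\<Sum>w\<in>Delta p. \<Prod>j<m. (1 + x * \<chi> w j)\<^sup>2)"
proof -
  have "poly P x = (1 + x) * (\<Sum>k\<le>m. wordlength (regular_design B) k * (2 * x) ^ k * (1 + x\<^sup>2) ^ (m - k))"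
    by (simp add: P_def poly_sum algebra_simps power2_eq_square)
  also have "\<dots> = (1 + x) * (1 / 4 ^ p * (\<Sum>w\<in>Delta p. \<Prod>j<m. 2 * x * \<chi> w j + (1 + x\<^sup>2)))"
    unfolding wordlength_enumerator ..
  also have "(\<Sum>w\<in>Delta p. \<Prod>j<m. 2 * x * \<chi> w j + (1 + x\<^sup>2)) = (\<Sum>w\<in>Delta p. \<Prod>j<m. (1 + x * \<chi> w j)\<^sup>2)"
  proof (intro sum.cong prod.cong refl)
    fix w j
    show "2 * x * \<chi> w j + (1 + x\<^sup>2) = (1 + x * \<chi> w j)\<^sup>2"
      using chi_cases[of "bin_form B j w"] by (auto simp: power2_eq_square algebra_simps)
  qed
  finally show ?thesis by simp
qed

text \<open>Each run gives \<open>2 * m + 1\<close> sign factors: every column of \<open>B\<close>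
  twice, because \<open>1 + x\<^sup>2 + 2 * x * s\<close> is a square for a sign \<open>s\<close>,
  and the factor \<open>1 + x\<close> once. Replacing \<open>x\<close> by \<open>- x\<close> flips
  all signs, which is the case \<open>s = - 1\<close>.\<close>

lemma poly_Q:
  assumes x: "\<bar>x\<bar> < 1"
  defines "r \<equiv> sqrt (1 - x\<^sup>2)" and "\<theta> \<equiv> ln ((1 + x) / sqrt (1 - x\<^sup>2))"
  shows "poly Q x = r ^ (2 * m + 1) / 4 ^ p *
    (\<Sum>w\<in>Delta p. exp (\<theta> * (2 * char_sum B w + 1)) + exp (- \<theta> * (2 * char_sum B w + 1)))"
proof -
  have lin: "1 + x * s = r * exp (\<theta> * s)" if "s = 1 \<or> s = - 1" for s
    using prod_signs_exp[OF x, of "{()}" "\<lambda>_. s"] that by (simp add: r_def \<theta>_def)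
  have "(1 + x * s) * (\<Prod>j<m. (1 + x * s * \<chi> w j)\<^sup>2) =
      r ^ (2 * m + 1) * exp (\<theta> * s * (2 * char_sum B w + 1))" if s: "s = 1 \<or> s = - 1" for s w
  proof -
    have "(\<Prod>j<m. 1 + x * (s * \<chi> w j)) = r ^ card {..<m} * exp (\<theta> * (\<Sum>j<m. s * \<chi> w j))"
      unfolding r_def \<theta>_def
    proof (rule prod_signs_exp[OF x])
      show "s * \<chi> w j = 1 \<or> s * \<chi> w j = - 1" for j
        using s chi_cases[of "bin_form B j w"] by auto
    qed simp
    then have pr: "(\<Prod>j<m. 1 + x * s * \<chi> w j) = r ^ m * exp (\<theta> * s * char_sum B w)"
      by (simp add: char_sum_def sum_distrib_left[symmetric] mult.assoc)
    have "(1 + x * s) * (\<Prod>j<m. (1 + x * s * \<chi> w j)\<^sup>2) = (r * exp (\<theta> * s)) * (r ^ m * exp (\<theta> * s * char_sum B w))\<^sup>2"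
      unfolding lin[OF s] prod_power_distrib[symmetric] pr ..
    also have "\<dots> = (r * (r ^ m)\<^sup>2) * (exp (\<theta> * s) * (exp (\<theta> * s * char_sum B w))\<^sup>2)"
      by (simp add: power_mult_distrib)
    also have "r * (r ^ m)\<^sup>2 = r ^ (2 * m + 1)"
      by (simp add: power_mult[symmetric] mult.commute)
    also have "exp (\<theta> * s) * (exp (\<theta> * s * char_sum B w))\<^sup>2 = exp (\<theta> * s * (2 * char_sum B w + 1))"
      by (simp add: power2_eq_square exp_add[symmetric] algebra_simps)
    finally show ?thesis .
  qed
  from this[of 1] this[of "- 1"]
  have e: "(1 + x) * (\<Prod>j<m. (1 + x * \<chi> w j)\<^sup>2) = r ^ (2 * m + 1) * exp (\<theta> * (2 * char_sum B w + 1))"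
    "(1 - x) * (\<Prod>j<m. (1 - x * \<chi> w j)\<^sup>2) = r ^ (2 * m + 1) * exp (- \<theta> * (2 * char_sum B w + 1))" for w
    by simp_all
  have "poly Q x = (1 + x) / 4 ^ p * (\<Sum>w\<in>Delta p. \<Prod>j<m. (1 + x * \<chi> w j)\<^sup>2)
      + (1 - x) / 4 ^ p * (\<Sum>w\<in>Delta p. \<Prod>j<m. (1 - x * \<chi> w j)\<^sup>2)"
    by (simp add: Q_def poly_pcompose poly_P)
  also have "\<dots> = 1 / 4 ^ p * (\<Sum>w\<in>Delta p. (1 + x) * (\<Prod>j<m. (1 + x * \<chi> w j)\<^sup>2)
      + (1 - x) * (\<Prod>j<m. (1 - x * \<chi> w j)\<^sup>2))"
  proof -
    have "u / c * a + v / c * b = 1 / c * (u * a + v * b)" for u v a b c :: real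
      by (simp add: add_divide_distrib)
    then show ?thesis unfolding sum.distrib sum_distrib_left[symmetric] .
  qed
  finally have "poly Q x = 1 / 4 ^ p * (\<Sum>w\<in>Delta p. (1 + x) * (\<Prod>j<m. (1 + x * \<chi> w j)\<^sup>2)
      + (1 - x) * (\<Prod>j<m. (1 - x * \<chi> w j)\<^sup>2))" .
  then show ?thesis
    unfolding e by (simp add: distrib_left[symmetric] sum_distrib_left[symmetric])
qed

lemma coeff_quadratic_power:
  "coeff ([:1, 0, 1:] ^ l :: real poly) i = (if even i then real (l choose (i div 2)) else 0)"
proof (induction l arbitrary: i)
  case 0
  then show ?case by (auto simp: binomial_eq_0 elim!: evenE)
next
  case (Suc l)
  have eq: "[:1, 0, 1:] ^ Suc l = [:1, 0, 1:] ^ l + pCons 0 (pCons 0 ([:1, 0, 1 :: real:] ^ l))"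
    by simp
  consider "i = 0" | "i = 1" | i' where "i = Suc (Suc i')"
    by (metis One_nat_def not0_implies_Suc)
  then show ?case
    unfolding eq by cases (auto simp: Suc.IH)
qed

text \<open>Powers of \<open>1 + x\<^sup>2\<close> have only even-indexed coefficients; the factor
  \<open>1 + x\<close> copies each of them to the next odd index, which amounts to rounding
  \<open>(j - k) / 2\<close> down.\<close>

lemma coeff_term:
  "coeff ([:1, 1:] * ([:0, 2:] ^ k * [:1, 0, 1:] ^ l) :: real poly) j =
    (if k \<le> j then 2 ^ k * real (l choose ((j - k) div 2)) else 0)"
proof -
  have mon: "[:0, 2:] ^ k = monom (2 ^ k :: real) k"
    by (induction k) (simp_all add: monom_altdef one_pCons mult.commute)
  have "coeff ([:1, 1:] * ([:1, 0, 1:] ^ l) :: real poly) i = real (l choose (i div 2))" for i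
    by (cases i) (auto simp: coeff_quadratic_power coeff_pCons elim!: evenE oddE)
  moreover have "[:1, 1:] * ([:0, 2:] ^ k * [:1, 0, 1:] ^ l) = monom (2 ^ k :: real) k * ([:1, 1:] * [:1, 0, 1:] ^ l)"
    unfolding mon by (simp only: mult.left_commute)
  ultimately show ?thesis by (simp only: coeff_monom_mult not_less) simp
qed

lemma wordlength_regular_0: "m < k \<Longrightarrow> wordlength (regular_design B) k = 0"
proof -
  assume "m < k"
  then have "card H \<noteq> k" if "H \<subseteq> {..<m}" for H
    using card_mono[OF finite_lessThan that] by simp
  then have no: "{H. H \<subseteq> {..<m} \<and> card H = k} = {}" by blast
  show ?thesis unfolding wordlength_regular no by simp
qed

lemma coeff_P: "coeff P (2 * r) = E_even (regular_design B) r"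
proof -
  have fl: "nat \<lfloor>real r - real k / 2\<rfloor> = (2 * r - k) div 2" if "k \<le> 2 * r" for k
  proof -
    have "real r - real k / 2 = real (2 * r - k) / 2" using that by (simp add: of_nat_diff)
    moreover have "\<lfloor>real (2 * r - k) / 2\<rfloor> = int ((2 * r - k) div 2)"
      using floor_divide_of_nat_eq[of "2 * r - k" 2, where ?'a = real] by (simp del: of_nat_diff)
    ultimately show ?thesis by (simp only: nat_int)
  qed
  have le_m: "k \<le> m" if "wordlength (regular_design B) k \<noteq> 0" for k
    using that wordlength_regular_0[of k] by (cases "k \<le> m") simp_all
  have "coeff P (2 * r) = (\<Sum>k\<le>m. wordlength (regular_design B) k *
      (if k \<le> 2 * r then 2 ^ k * real ((m - k) choose ((2 * r - k) div 2)) else 0))"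
    unfolding P_def sum_distrib_left mult_smult_right coeff_sum coeff_smult coeff_term ..
  also have "\<dots> = (\<Sum>k | k \<le> m \<and> k \<le> 2 * r. wordlength (regular_design B) k *
      (2 ^ k * real ((m - k) choose ((2 * r - k) div 2))))"
    by (rule sum.mono_neutral_cong_right) auto
  also have "\<dots> = (\<Sum>k = 0..2 * r. real ((m - k) choose nat \<lfloor>real r - real k / 2\<rfloor>) * 2 ^ k * wordlength (regular_design B) k)"
    by (rule sum.mono_neutral_cong_left) (auto simp: fl intro: le_m)
  finally show ?thesis by (simp add: E_even_def regular_design_def)
qed

lemma coeff_Q: "coeff Q j = (if even j then 2 * E_even (regular_design B) (j div 2) else 0)"
proof -
  have "coeff Q j = coeff P j * (1 + (- 1) ^ j)"
    by (simp add: Q_def coeff_pcompose_linear algebra_simps)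
  then show ?thesis using coeff_P by (auto elim!: evenE)
qed

end

section \<open>Lexicographic comparison\<close>

text \<open>The exponential substitution is available only for \<open>\<bar>x\<bar> < 1\<close>, but
  this interval already has infinitely many points.\<close>

lemma poly_eqI_unit_interval:
  fixes p q :: "real poly"
  assumes "\<And>x. \<bar>x\<bar> < 1 \<Longrightarrow> poly p x = poly q x"
  shows "p = q"
proof (rule ccontr)
  assume "p \<noteq> q"
  then have "finite {x. poly (p - q) x = 0}" by (intro poly_roots_finite) simp
  moreover have "{0<..<1 :: real} \<subseteq> {x. poly (p - q) x = 0}" using assms by auto
  ultimately have "finite {0<..<1 :: real}" using finite_subset by blast
  then show False using infinite_Ioo[of 0 "1 :: real"] by simp
qed

text \<open>As long as \<open>q\<close> and \<open>q'\<close> agree below \<open>k\<close>, only the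
  constant term of \<open>r\<close> reaches index \<open>k\<close>. For positive \<open>c\<close>
  the first difference therefore has the same sign on both sides.\<close>

lemma coeff_diff_leading:
  fixes p p' q q' r :: "real poly"
  assumes eq: "p - p' = smult c (r * (q - q'))" and r: "coeff r 0 = 1"
    and "\<forall>j<k. coeff q j = coeff q' j"
  shows "coeff p k - coeff p' k = c * (coeff q k - coeff q' k)"
proof -
  have "coeff (r * (q - q')) k = (\<Sum>i\<le>k. coeff r i * coeff (q - q') (k - i))"
    by (rule coeff_mult)
  also have "\<dots> = (\<Sum>i\<in>{0}. coeff r i * coeff (q - q') (k - i))"
    by (rule sum.mono_neutral_right) (use assms(3) in auto)
  finally show ?thesis
    using arg_cong[OF eq, of "\<lambda>p. coeff p k"] r by simp
qed

lemma coeff_agree_iff: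
  fixes p p' q q' r :: "real poly"
  assumes eq: "p - p' = smult c (r * (q - q'))" and r: "coeff r 0 = 1" and c: "c \<noteq> 0"
  shows "(\<forall>j<k. coeff p j = coeff p' j) \<longleftrightarrow> (\<forall>j<k. coeff q j = coeff q' j)"
proof
  assume q: "\<forall>j<k. coeff q j = coeff q' j"
  show "\<forall>j<k. coeff p j = coeff p' j"
  proof (intro allI impI)
    fix j assume j: "j < k"
    then have "coeff p j - coeff p' j = c * (coeff q j - coeff q' j)"
      using q by (intro coeff_diff_leading[OF eq r]) auto
    then show "coeff p j = coeff p' j" using q j by simp
  qed
next
  assume p: "\<forall>j<k. coeff p j = coeff p' j"
  have "j < k \<Longrightarrow> coeff q j = coeff q' j" for j
  proof (induction j rule: less_induct)
    case (less j)
    then have "coeff p j - coeff p' j = c * (coeff q j - coeff q' j)"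
      by (intro coeff_diff_leading[OF eq r]) auto
    then show ?case using p less.prems c by simp
  qed
  then show "\<forall>j<k. coeff q j = coeff q' j" by blast
qed

text \<open>The \<open>even_const\<close> parts depend only on \<open>n\<close>, \<open>m\<close>
  and \<open>\<theta>\<close> and cancel. The exponent splits as
  \<open>2 * s + 1 = 2 * (s - m) + (2 * m + 1)\<close>, and the constant is what remains of
  \<open>2 / (2 * 4 ^ n)\<close> after extracting \<open>1 / 4 ^ (n - 1)\<close>.\<close>

lemma gen_poly_diff:
  assumes Q: "QC_even n T g i B hs" "QC_even n T' g' i' B' hs'"
    and M: "binary_mat (n - 1) m B" "binary_mat (n - 1) m B'"
    and s: "card T = Suc s" "card T' = Suc s" "m \<le> s"
    and b: "b \<in> {1, 2}" "b' \<in> {1, 2}"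
  shows "gen_poly (QC_design.D n T g b) - gen_poly (QC_design.D n T' g' b') =
    smult (1 / 4) ([:1, 0, - 1:] ^ (s - m) * (binary_mat.Q m B - binary_mat.Q m B'))"
proof (rule poly_eqI_unit_interval)
  fix x :: real assume x: "\<bar>x\<bar> < 1"
  interpret X: QC_even n T g i B hs by (rule Q)
  interpret X': QC_even n T' g' i' B' hs' by (rule Q)
  interpret Y: binary_mat "n - 1" m B by (rule M)
  interpret Y': binary_mat "n - 1" m B' by (rule M)
  define r where "r = sqrt (1 - x\<^sup>2)"
  define \<theta> where "\<theta> = ln ((1 + x) / sqrt (1 - x\<^sup>2))"
  define S where "S B = (\<Sum>w\<in>Delta (n - 1). exp (\<theta> * (2 * char_sum B w + 1)) + exp (- \<theta> * (2 * char_sum B w + 1)))" for B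
  define C where "C = (\<Sum>a\<in>UNIV. \<Sum>w\<in>Delta (n - 1). even_const n m \<theta> a w)"
  have "x\<^sup>2 \<le> 1" using x by (simp add: abs_square_le_1)
  then have r2: "r\<^sup>2 = 1 - x\<^sup>2" by (simp add: r_def)
  have q: "2 * card T - 1 = 2 * s + 1" "2 * card T' - 1 = 2 * s + 1" using s by auto
  have n: "(4 :: real) ^ n = 4 * 4 ^ (n - 1)" using X.i(1) by (cases n) auto
  have "2 * s + 1 = 2 * (s - m) + (2 * m + 1)" using s by simp
  then have "r ^ (2 * s + 1) = (r\<^sup>2) ^ (s - m) * r ^ (2 * m + 1)"
    by (simp only: power_add power_mult)
  then have rs: "r ^ (2 * s + 1) = (1 - x\<^sup>2) ^ (s - m) * r ^ (2 * m + 1)" unfolding r2 .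
  have "poly (gen_poly (QC_design.D n T g b) - gen_poly (QC_design.D n T' g' b')) x =
      r ^ (2 * s + 1) / (2 * 4 ^ n) * (C + 2 * S B) - r ^ (2 * s + 1) / (2 * 4 ^ n) * (C + 2 * S B')"
    unfolding poly_diff X.poly_gen_poly[OF x b(1)] X'.poly_gen_poly[OF x b(2)] q Y.dims Y'.dims
      r_def \<theta>_def S_def C_def ..
  also have "\<dots> = 1 / 4 * ((1 - x\<^sup>2) ^ (s - m) * (r ^ (2 * m + 1) / 4 ^ (n - 1) * S B - r ^ (2 * m + 1) / 4 ^ (n - 1) * S B'))"
    unfolding rs n by (simp add: field_simps)
  also have "\<dots> = poly (smult (1 / 4) ([:1, 0, - 1:] ^ (s - m) * (binary_mat.Q m B - binary_mat.Q m B'))) x"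
    unfolding poly_smult poly_mult poly_diff poly_power Y.poly_Q[OF x] Y'.poly_Q[OF x] r_def \<theta>_def S_def
    by (simp add: power2_eq_square)
  finally show "poly (gen_poly (QC_design.D n T g b) - gen_poly (QC_design.D n T' g' b')) x =
    poly (smult (1 / 4) ([:1, 0, - 1:] ^ (s - m) * (binary_mat.Q m B - binary_mat.Q m B'))) x" .
qed

lemma binary_mat_binary_matrices: "B \<in> binary_matrices p m \<Longrightarrow> binary_mat p m B"
proof
  assume B: "B \<in> binary_matrices p m"
  then show c: "B \<in> carrier_mat p m" by (simp add: binary_matrices_def)
  fix k j assume "k < p" "j < m"
  then have "B $$ (k, j) \<in> elements_mat B" using c by (intro elements_matI) auto
  then show "B $$ (k, j) \<in> {0, 1}" using B by (auto simp: binary_matrices_def)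
qed

section \<open>Even sets and binary matrices\<close>

lemma distinct_cols: "distinct (cols B) \<longleftrightarrow> inj_on (col B) {..<dim_col B}"
  by (simp add: cols_def distinct_map atLeast0LessThan)

lemma z4_same_parity:
  "(z4_even a \<longleftrightarrow> z4_even b) \<Longrightarrow> a = b + 2 * of_nat (if a = b then 0 else 1)"
  by (cases a rule: z4_exhaust; cases b rule: z4_exhaust) (simp_all add: z4_even_def)

text \<open>Vectors of \<open>Omega n\<close> congruent modulo 2 have their first odd entry at the
  same place, where all equal 1; the other entries differ from those of \<open>g\<close> by 0 or 2,
  which \<open>B\<close> records. Distinct vectors give distinct columns, and no column is null
  because \<open>g\<close> lies in \<open>T\<close>.\<close>

lemma (in QC_design) even_set_representation:
  assumes is_even
  obtains i B hs where "QC_even n T g i B hs" "B \<in> binary_matrices (n - 1) (card (Omega n - T))"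
proof -
  define m where "m = card (Omega n - T)"
  have gO: "g \<in> Omega n" using T g by blast
  then obtain i where i: "i < n" "g $ i = 1" "\<forall>j<i. z4_even (g $ j)" "\<not> z4_even (g $ i)"
    by (auto simp: Omega_def)
  obtain hs where "bij_betw hs {0..<m} (Omega n - T)"
    using ex_bij_betw_nat_finite[of "Omega n - T"] m_def by auto
  then have hs: "bij_betw hs {..<m} (Omega n - T)" by (simp add: atLeast0LessThan)
  have hO: "hs j \<in> Omega n" "hs j \<notin> T" if "j < m" for j
    using bij_betwE[OF hs] that by auto
  have dim: "dim_vec g = n" "j < m \<Longrightarrow> dim_vec (hs j) = n" for j
    using gO hO OmegaD Delta_dim by blast+
  have par: "z4_even (hs j $ k) \<longleftrightarrow> z4_even (g $ k)" if "j < m" "k < n" for j k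
  proof -
    have "g + hs j \<in> Even n"
      using assms bij_betwE[OF hs] that unfolding is_even_def by auto
    then show ?thesis using that dim by (auto simp: Even_def z4_even_add)
  qed
  have hi: "hs j $ i = 1" if j: "j < m" for j
  proof -
    obtain k where k: "k < n" "hs j $ k = 1" "\<forall>l<k. z4_even (hs j $ l)" "\<not> z4_even (hs j $ k)"
      using hO(1)[OF j] by (auto simp: Omega_def)
    have "\<not> k < i" using par[OF j k(1)] k(4) i(3) by blast
    moreover have "\<not> i < k" using par[OF j i(1)] k(3) i(4) by blast
    ultimately have "k = i" by simp
    then show ?thesis using k(2) by simp
  qed
  define B where "B = mat (n - 1) m (\<lambda>(k, j). if hs j $ skip i k = g $ skip i k then 0 else 1 :: nat)"
  have Bdim: "dim_row B = n - 1" "dim_col B = m" by (simp_all add: B_def)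
  have hB: "hs j $ skip i k = g $ skip i k + 2 * of_nat (B $$ (k, j))" if "j < m" "k < n - 1" for j k
  proof -
    have "B $$ (k, j) = (if hs j $ skip i k = g $ skip i k then 0 else 1)"
      using that by (simp add: B_def)
    then show ?thesis
      using z4_same_parity[OF par[OF that(1) skip_less[OF i(1) that(2)]]] by (simp only:)
  qed
  have Q: "QC_even n T g i B hs"
    using hs i hi hB by unfold_locales (simp_all add: Bdim)
  have eqI: "hs j = w" if "j < m" "dim_vec w = n" "w $ i = 1" "\<And>k. k < n - 1 \<Longrightarrow> hs j $ skip i k = w $ skip i k" for j w
  proof (rule eq_vecI)
    fix k assume "k < dim_vec w"
    then have "k < n" using that by simp
    then show "hs j $ k = w $ k"
      using hi[OF that(1)] that(3,4) by (cases rule: skip_cases[OF i(1)]) auto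
  qed (use that dim in simp)
  have inj_col: "inj_on (col B) {..<m}"
  proof (rule inj_onI)
    fix j j' assume j: "j \<in> {..<m}" "j' \<in> {..<m}" and eq: "col B j = col B j'"
    have "B $$ (k, j) = B $$ (k, j')" if "k < n - 1" for k
      using arg_cong[OF eq, of "\<lambda>v. v $ k"] that j Bdim by simp
    then have "hs j = hs j'" using j hi dim by (intro eqI) (auto simp: hB)
    then show "j = j'" using inj_onD[OF bij_betw_imp_inj_on[OF hs]] j by blast
  qed
  have no_null: "0\<^sub>v (n - 1) \<noteq> col B j" if j: "j < m" for j
  proof
    assume eq: "0\<^sub>v (n - 1) = col B j"
    have "B $$ (k, j) = 0" if "k < n - 1" for k
      using arg_cong[OF eq, of "\<lambda>v. v $ k"] that j Bdim by simp
    then have "hs j = g" using j i dim by (intro eqI) (auto simp: hB)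
    then show False using hO(2)[OF j] g by simp
  qed
  have "0\<^sub>v (n - 1) \<notin> set (cols B)"
  proof
    assume "0\<^sub>v (n - 1) \<in> set (cols B)"
    then obtain j where "j < m" "0\<^sub>v (n - 1) = col B j" unfolding cols_def Bdim by auto
    then show False using no_null by blast
  qed
  moreover have "elements_mat B \<subseteq> {0, 1}" by (auto simp: elements_mat_def B_def)
  moreover have "B \<in> carrier_mat (n - 1) m" using Bdim by blast
  ultimately have "B \<in> binary_matrices (n - 1) m"
    using inj_col by (simp add: binary_matrices_def distinct_cols Bdim)
  then show thesis using that Q m_def by blast
qed

text \<open>Conversely, every admissible matrix is realized, with the first unit vector as
  \<open>g\<close>. Doubling is injective on 0 and 1 modulo 4, so distinct nonnull columns become
  distinct vectors different from \<open>g\<close>.\<close>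

lemma QC_even_G_bar:
  assumes n: "0 < n" and B: "B \<in> binary_matrices (n - 1) m"
  defines "S \<equiv> set (cols (G_bar B))" and "g \<equiv> col (G_bar B) 0"
  shows "S \<subseteq> Omega n" "g \<in> S" "card S = Suc m"
    "QC_even n (insert g (Omega n - S)) g 0 B (\<lambda>j. col (G_bar B) (Suc j))"
proof -
  interpret binary_mat "n - 1" m B by (rule binary_mat_binary_matrices[OF B])
  define hs where "hs j = col (G_bar B) (Suc j)" for j
  have dG: "dim_row (G_bar B) = n" "dim_col (G_bar B) = Suc m"
    using n by (simp_all add: G_bar_def)
  have g: "g $ 0 = 1" "\<And>k. k < n - 1 \<Longrightarrow> g $ Suc k = 0" "dim_vec g = n"
    using n by (auto simp: g_def G_bar_def)
  have h: "hs j $ 0 = 1" "\<And>k. k < n - 1 \<Longrightarrow> hs j $ Suc k = 2 * of_nat (B $$ (k, j))" "dim_vec (hs j) = n"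
    if "j < m" for j
    using n that by (auto simp: hs_def G_bar_def)
  have S: "S = insert g (hs ` {..<m})"
    unfolding S_def cols_def dG set_map set_upt atLeast0LessThan lessThan_Suc_eq_insert_0 g_def hs_def
    by (simp only: image_insert image_image)
  have inj: "inj_on hs {..<m}" and ng: "g \<notin> hs ` {..<m}"
  proof -
    have d: "(2 :: z4) * of_nat a = 2 * of_nat b \<Longrightarrow> a = b" if "a \<in> {0, 1}" "b \<in> {0, 1}" for a b
      using that by auto
    show "inj_on hs {..<m}"
    proof (rule inj_onI)
      fix j j' assume j: "j \<in> {..<m}" "j' \<in> {..<m}" and eq: "hs j = hs j'"
      have "B $$ (k, j) = B $$ (k, j')" if "k < n - 1" for k
        using arg_cong[OF eq, of "\<lambda>v. v $ Suc k"] that j h(2) entries by (intro d) auto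
      then have "col B j = col B j'" using j by (intro eq_vecI) auto
      moreover have "inj_on (col B) {..<m}"
      proof -
        have "distinct (cols B)" using assms(2) by (simp add: binary_matrices_def)
        then show ?thesis unfolding distinct_cols dims .
      qed
      ultimately show "j = j'" using j by (simp add: inj_on_eq_iff)
    qed
    show "g \<notin> hs ` {..<m}"
    proof
      assume "g \<in> hs ` {..<m}"
      then obtain j where j: "j < m" "g = hs j" by auto
      have "B $$ (k, j) = 0" if "k < n - 1" for k
        using arg_cong[OF j(2), of "\<lambda>v. v $ Suc k"] that j(1) h(2) g(2) entries by (intro d) auto
      then have "col B j = 0\<^sub>v (n - 1)" using j by (intro eq_vecI) auto
      then have "0\<^sub>v (n - 1) \<in> set (cols B)" using j by (auto simp: cols_def image_iff intro!: bexI[of _ j])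
      then show False using assms(2) by (simp add: binary_matrices_def)
    qed
  qed
  have O: "w \<in> Omega n" if "w $ 0 = 1" "dim_vec w = n" for w
    using that n by (auto simp: Omega_def Delta_def z4_even_def intro!: exI[of _ 0] carrier_vecI)
  show SO: "S \<subseteq> Omega n" unfolding S using O g h by auto
  show gS: "g \<in> S" unfolding S by simp
  show "card S = Suc m" unfolding S using ng by (simp add: card_image[OF inj])
  have R: "Omega n - insert g (Omega n - S) = hs ` {..<m}"
    using SO ng unfolding S by auto
  show "QC_even n (insert g (Omega n - S)) g 0 B (\<lambda>j. col (G_bar B) (Suc j))"
    unfolding hs_def[symmetric]
    using SO gS n g h inj
    by unfold_locales (auto simp: R bij_betw_def skip_def)
qed

lemma QC_designs_oddE:
  assumes "D \<in> QC_designs_odd n s"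
  obtains U h b where "U \<subseteq> Omega n" "card U = Suc s" "D = delete_factor (h, b) (even_design n U)"
    "h \<in> U" "b \<in> {1, 2}"
proof -
  obtain c U where U: "D = delete_factor c (even_design n U)" "U \<subseteq> Omega n" "card U = s + 1"
    "c \<in> U \<times> {1, 2}"
    using assms unfolding QC_designs_odd_def by blast
  obtain h b where "c = (h, b)" by (cases c)
  then show thesis using U that[of U h b] by simp
qed

theorem theorem4:
  fixes n v s :: nat and B :: "nat mat" and S :: "z4 vec set"
  assumes "2 \<le> n" and "v = (4 ^ n - 2 ^ n) div 2"
    and "2 \<le> v - s" and "v - s \<le> 2 ^ (n - 1)"
    and "B \<in> binary_matrices (n - 1) (v - s - 1)"
    and "S = set (cols (G_bar B))" and "S \<subseteq> Omega n" and "even_set S"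
  shows "MA_QC_design n s (yielded_design n S (col (G_bar B) 0)) \<longleftrightarrow>
    sequentially_minimizes (regular_design ` binary_matrices (n - 1) (v - s - 1))
      E_even {2..} (regular_design B)"
proof -
  define m where "m = v - s - 1"
  have v: "v = card (Omega n)" "v = Suc (s + m)" using assms(2,3) by (auto simp: card_Omega m_def)
  \<comment> \<open>The goal is \<open>m < s\<close>, which makes \<open>s - m\<close> a genuine
    difference in \<open>gen_poly_diff\<close>. For \<open>2 \<le> n\<close> the total
    \<open>v\<close> is at least \<open>2 ^ n\<close>, that is, at least twice the bound on
    \<open>v - s = m + 1\<close>.\<close>
  have "(4::nat) ^ n = 2 ^ n * 2 ^ n" by (simp add: power_mult_distrib[symmetric])
  moreover have "(4::nat) \<le> 2 ^ n" using assms(1) power_increasing[of 2 n "2::nat"] by simp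
  then have "4 * 2 ^ n \<le> (2::nat) ^ n * 2 ^ n" by (rule mult_right_mono) simp
  moreover have "x \<le> (y - x) div 2" if "4 * x \<le> y" for x y :: nat using that by linarith
  ultimately have "2 ^ n \<le> v" unfolding assms(2) by metis
  moreover have "(2::nat) ^ n = 2 * 2 ^ (n - 1)" using assms(1) by (cases n) auto
  ultimately have ms: "m < s" using v assms(3,4) by simp
  have n0: "0 < n" using assms(1) by simp

  define g where "g B' = col (G_bar B') 0" for B'
  define T where "T B' = insert (g B') (Omega n - set (cols (G_bar B')))" for B'
  define Y where "Y B' = QC_design.D n (T B') (g B') 2" for B'
  define hs where "hs B' j = col (G_bar B') (Suc j)" for B' j
  let ?M = "binary_matrices (n - 1) m"
  let ?W = "\<lambda>D. coeff (gen_poly D)"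
  have even: "QC_even n (T B') (g B') 0 B' (hs B')" if "B' \<in> ?M" for B'
    unfolding T_def g_def hs_def by (rule QC_even_G_bar(4)[OF n0 that])
  have cT: "card (T B') = Suc s" if "B' \<in> ?M" for B'
  proof -
    note G = QC_even_G_bar[OF n0 that]
    have "card (Omega n - set (cols (G_bar B'))) = s"
      using G(1,3) v by (simp add: card_Diff_subset)
    then show ?thesis using G(2) by (simp add: T_def g_def)
  qed
  have QC: "QC_design n (T B') (g B')" if "B' \<in> ?M" for B'
    using even[OF that] by (rule QC_even.axioms(1))
  have Y_mem: "Y B' \<in> QC_designs_odd n s" if "B' \<in> ?M" for B'
  proof -
    have "T B' \<subseteq> Omega n" "g B' \<in> T B'" using QC[OF that] by (simp_all add: QC_design_def)
    then show ?thesis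
      unfolding Y_def QC_design.D_def[OF QC[OF that]] QC_designs_odd_def
      using cT[OF that] by (intro CollectI exI[of _ "(g B', 2)"] exI[of _ "T B'"]) simp
  qed
  have W: "wordlength D = ?W D" if D: "D \<in> QC_designs_odd n s" for D
  proof -
    from D obtain U h b where U: "U \<subseteq> Omega n" "D = delete_factor (h, b) (even_design n U)"
      by (rule QC_designs_oddE)
    have "finite U" using U(1) finite_subset finite_Omega by blast
    then have "finite (factors D)" by (simp add: U(2) delete_factor_def even_design_def)
    then show ?thesis by (intro ext) (simp add: coeff_gen_poly)
  qed
  \<comment> \<open>Together with \<open>large\<close> below, this shows that agreement on the
    indices from 3 to \<open>2 * s + 1\<close> is agreement of whole coefficient sequences, the form
    needed for the polynomial identities.\<close>
  have small: "?W D j = (if j = 0 then 1 else 0)" if D: "D \<in> QC_designs_odd n s" and "j < 3" for D j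
  proof -
    from D obtain U h b where U: "U \<subseteq> Omega n" "D = delete_factor (h, b) (even_design n U)" "h \<in> U" "b \<in> {1, 2}"
      by (rule QC_designs_oddE)
    interpret QC_design n U h by unfold_locales (use U in auto)
    have "j = 0 \<or> j = 1 \<or> j = 2" using that by linarith
    then show ?thesis
      unfolding W[OF D, symmetric] unfolding U(2) D_def[symmetric]
      using wordlength_le_2[OF U(4)] by auto
  qed
  have large: "?W D j = 0" if D: "D \<in> QC_designs_odd n s" and j: "2 * s + 1 < j" for D j
  proof -
    from D obtain U h b where U: "U \<subseteq> Omega n" "card U = Suc s"
      "D = delete_factor (h, b) (even_design n U)" "h \<in> U" "b \<in> {1, 2}"
      by (rule QC_designs_oddE)
    interpret QC_design n U h by unfold_locales (use U in auto)
    have "factors D = U \<times> {1, 2} - {(h, b)}" unfolding U(3) by (simp add: delete_factor_def even_design_def)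
    then have "card (factors D) = 2 * s + 1" "finite (factors D)"
      using card_columns[OF U(5)] U(2) finite_T by simp_all
    then have "card H \<noteq> j" if "H \<subseteq> factors D" for H
      using j card_mono[OF _ that] by simp
    then have no: "{H. H \<subseteq> factors D \<and> card H = j} = {}" by blast
    show ?thesis unfolding W[OF D, symmetric] unfolding wordlength_def no by simp
  qed
  have diff: "gen_poly (Y B') - gen_poly D = smult (1 / 4) ([:1, 0, - 1:] ^ (s - m) * (binary_mat.Q m B' - binary_mat.Q m B''))"
    if "B' \<in> ?M" "B'' \<in> ?M" "D = QC_design.D n U h b" "QC_even n U h i B'' ks" "card U = Suc s" "b \<in> {1, 2}"
    for B' B'' D U h b i ks
    unfolding Y_def that(3) using that ms even cT binary_mat_binary_matrices
    by (intro gen_poly_diff) auto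
  have r0: "coeff ([:1, 0, - 1 :: real:] ^ (s - m)) 0 = 1"
    by (simp add: coeff_0_power)
  have Qc: "coeff (binary_mat.Q m B') j = (if even j then 2 * E_even (regular_design B') (j div 2) else 0)"
    if "B' \<in> ?M" for B' j
    using binary_mat.coeff_Q[OF binary_mat_binary_matrices[OF that]] .

  have BM: "B \<in> ?M" using assms(5) by (simp add: m_def)
  have comp: "card (Omega n - U) = m" if "U \<subseteq> Omega n" "card U = Suc s" for U
    using that v finite_subset[OF that(1) finite_Omega] by (simp add: card_Diff_subset)
  have B_even: "QC_design.is_even n (T B) (g B)"
  proof -
    have Seq: "insert (g B) (Omega n - T B) \<subseteq> S"
      using assms(6,7) QC_even_G_bar(2)[OF n0 BM] by (auto simp: T_def g_def)
    have "x + y \<in> Even n" if "x \<in> S" "y \<in> S" for x y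
      using assms(7,8) that OmegaD[of x n] OmegaD[of y n] by (auto simp: even_set_def Even_def)
    then show ?thesis unfolding QC_design.is_even_def[OF QC[OF BM]] using Seq by blast
  qed

  \<comment> \<open>In this direction the only competitors needed are the designs
    \<open>Y B'\<close>.\<close>
  have MA_SM: "sequentially_minimizes (regular_design ` ?M) E_even {2..} (regular_design B)"
    if MA: "MA_QC_design n s (Y B)"
    unfolding sequentially_minimizes_def
  proof (intro conjI ballI impI)
    show "regular_design B \<in> regular_design ` ?M" using BM by simp
  next
    fix k D' assume k: "k \<in> {2 :: nat..}" and D': "D' \<in> regular_design ` ?M"
      and agree: "\<forall>j\<in>{2..}. j < k \<longrightarrow> E_even D' j = E_even (regular_design B) j"
    obtain B' where B': "B' \<in> ?M" "D' = regular_design B'" using D' by blast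
    note eq = diff[OF BM B'(1) Y_def even[OF B'(1)] cT[OF B'(1)], simplified]
    have p3: "\<forall>j<3. coeff (gen_poly (Y B)) j = coeff (gen_poly (Y B')) j"
      using small[OF Y_mem[OF BM]] small[OF Y_mem[OF B'(1)]] by simp
    have q3: "\<forall>j<3. coeff (binary_mat.Q m B) j = coeff (binary_mat.Q m B') j"
      using p3 coeff_agree_iff[OF eq r0] by simp
    \<comment> \<open>The index \<open>r\<close> starts at 2, so the coefficients at 0 and 2 are not
      covered by the assumption; they agree because the wordlength patterns agree below 3. Odd
      coefficients of \<open>Q\<close> vanish.\<close>
    have q: "\<forall>j<2 * k. coeff (binary_mat.Q m B) j = coeff (binary_mat.Q m B') j"
    proof (intro allI impI)
      fix j assume j: "j < 2 * k"
      show "coeff (binary_mat.Q m B) j = coeff (binary_mat.Q m B') j"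
      proof (cases "j < 3 \<or> odd j")
        case True
        then show ?thesis using q3 Qc[OF BM] Qc[OF B'(1)] by auto
      next
        case False
        then have "2 \<le> j div 2" "j div 2 < k" using j by (auto elim!: evenE)
        then have "E_even D' (j div 2) = E_even (regular_design B) (j div 2)" using agree by simp
        then show ?thesis using Qc[OF BM] Qc[OF B'(1)] B'(2) by simp
      qed
    qed
    then have p: "\<forall>j<2 * k. coeff (gen_poly (Y B)) j = coeff (gen_poly (Y B')) j"
      using coeff_agree_iff[OF eq r0] by simp
    have "coeff (gen_poly (Y B)) (2 * k) \<le> coeff (gen_poly (Y B')) (2 * k)"
    proof (cases "2 * k \<le> 2 * s + 1")
      case True
      then have "2 * k \<in> {3..2 * s + 1}" using k by simp
      then show ?thesis
        using MA Y_mem[OF B'(1)] p W[OF Y_mem[OF BM]] W[OF Y_mem[OF B'(1)]]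
        unfolding MA_QC_design_def sequentially_minimizes_def by metis
    next
      case False
      then show ?thesis using large[OF Y_mem[OF BM]] large[OF Y_mem[OF B'(1)]] by simp
    qed
    then have "coeff (binary_mat.Q m B) (2 * k) \<le> coeff (binary_mat.Q m B') (2 * k)"
      using coeff_diff_leading[OF eq r0 q] by simp
    then show "E_even (regular_design B) k \<le> E_even D' k"
      using Qc[OF BM] Qc[OF B'(1)] B'(2) by simp
  qed

  have SM_MA: "MA_QC_design n s (Y B)"
    if SM: "sequentially_minimizes (regular_design ` ?M) E_even {2..} (regular_design B)"
    unfolding MA_QC_design_def sequentially_minimizes_def
  proof (intro conjI ballI impI)
    show "Y B \<in> QC_designs_odd n s" by (rule Y_mem[OF BM])
  next
    fix k D assume k: "k \<in> {3..2 * s + 1}" and D: "D \<in> QC_designs_odd n s"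
      and agree: "\<forall>j\<in>{3..2 * s + 1}. j < k \<longrightarrow> wordlength D j = wordlength (Y B) j"
    obtain U h b where U: "U \<subseteq> Omega n" "card U = Suc s"
      "D = delete_factor (h, b) (even_design n U)" "h \<in> U" "b \<in> {1, 2}"
      using D by (rule QC_designs_oddE)
    interpret QC_design n U h by unfold_locales (use U in auto)
    have D_eq: "D = QC_design.D n U h b" unfolding U(3) D_def ..
    show "wordlength (Y B) k \<le> wordlength D k"
    proof (cases is_even)
      case True
      \<comment> \<open>An even competitor need not have the form of \<open>G_bar\<close>, but it
        has a binary matrix of its own with respect to \<open>h\<close>, and this suffices for
        comparing the generating polynomials.\<close>
      obtain i B' ks where B': "QC_even n U h i B' ks" "B' \<in> ?M"
        using even_set_representation[OF True] unfolding comp[OF U(1,2)] by metis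
      note eq = diff[OF BM B'(2) D_eq B'(1) U(2,5)]
      have p: "\<forall>j<k. coeff (gen_poly (Y B)) j = coeff (gen_poly D) j"
      proof (intro allI impI)
        fix j assume j: "j < k"
        show "coeff (gen_poly (Y B)) j = coeff (gen_poly D) j"
        proof (cases "j < 3")
          case True
          then show ?thesis using small[OF Y_mem[OF BM]] small[OF D] by simp
        next
          case False
          then have "wordlength D j = wordlength (Y B) j" using agree j k by simp
          then show ?thesis using W[OF D] W[OF Y_mem[OF BM]] by simp
        qed
      qed
      then have q: "\<forall>j<k. coeff (binary_mat.Q m B) j = coeff (binary_mat.Q m B') j"
        using coeff_agree_iff[OF eq r0] by simp
      have "coeff (binary_mat.Q m B) k \<le> coeff (binary_mat.Q m B') k"
      \<comment> \<open>At odd indices both coefficients of \<open>Q\<close> are zero, so once all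
        earlier entries agree there is nothing to minimize.\<close>
      proof (cases "even k")
        case False
        then show ?thesis using Qc[OF BM] Qc[OF B'(2)] by simp
      next
        case True
        then obtain r where r: "k = 2 * r" by (rule evenE)
        have "E_even (regular_design B') j = E_even (regular_design B) j" if "j < r" for j
        proof -
          have "coeff (binary_mat.Q m B) (2 * j) = coeff (binary_mat.Q m B') (2 * j)"
            using q that r by simp
          then show ?thesis using Qc[OF BM] Qc[OF B'(2)] by simp
        qed
        moreover have "r \<in> {2..}" using k r by simp
        ultimately have "E_even (regular_design B) r \<le> E_even (regular_design B') r"
          using SM B'(2) unfolding sequentially_minimizes_def by blast
        then show ?thesis using Qc[OF BM] Qc[OF B'(2)] r by simp
      qed
      then have "coeff (gen_poly (Y B)) k \<le> coeff (gen_poly D) k"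
        using coeff_diff_leading[OF eq r0 q] by simp
      then show ?thesis using W[OF D] W[OF Y_mem[OF BM]] by simp
    next
      case False
      have "wordlength (Y B) 3 = min_wordlength_3 n m"
        unfolding Y_def QC_design.wordlength_3_even[OF QC[OF BM] _ B_even, of 2, simplified]
        using comp[of "T B"] QC[OF BM] cT[OF BM] by (simp add: QC_design_def)
      also have "\<dots> < wordlength D 3"
        using wordlength_3_not_even[OF U(5) False] unfolding comp[OF U(1,2)] D_eq .
      finally have lt: "wordlength (Y B) 3 < wordlength D 3" .
      \<comment> \<open>The third entries already differ, so no later stage of the comparison with
        this competitor can be reached.\<close>
      have "k = 3"
      proof (rule ccontr)
        assume "k \<noteq> 3"
        then have "3 < k" "3 \<in> {3..2 * s + 1}" using k by auto
        then show False using agree lt by auto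
      qed
      then show ?thesis using lt by simp
    qed
  qed

  have "yielded_design n S (col (G_bar B) 0) = Y B"
    unfolding Y_def QC_design.D_def[OF QC[OF BM]] unfolding T_def g_def yielded_design_def assms(6) ..
  then show ?thesis using MA_SM SM_MA unfolding m_def by metis
qed

end
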